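(* Let $\mathbf{X}=(X_\lambda,p_{\lambda\lambda'},\Lambda)$, $\mathbf{Y}=(Y_\mu,q_{\mu\mu'},M)$ and $\mathbf{Z}=(Z_\nu,r_{\nu\nu'},N)$ be inverse systems of spaces (inverse systems in the homotopy category $\mathrm{HTop}$), and let $\mathbf{f}^*:\mathbf{Z}\to\mathbf{X}$ and $\mathbf{g}^*:\mathbf{Z}\to\mathbf{Y}$ be morphisms of $\mathrm{pro}^*\text{-}\mathrm{HTop}$. Then there exists a unique morphism $\mathbf{h}^*:\mathbf{Z}\to\mathbf{X}\times\mathbf{Y}$ in $\mathrm{pro}^*\text{-}\mathrm{HTop}$ such that $\pi^*_{\mathbf{X}}\mathbf{h}^*=\mathbf{f}^*$ and $\pi^*_{\mathbf{Y}}\mathbf{h}^*=\mathbf{g}^*$.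
   Context: $\mathrm{HTop}$ is the homotopy category of topological spaces: objects are topological spaces, morphisms are homotopy classes of continuous maps. Inverse systems are indexed by directed sets, and every inverse system is assumed to be cofinite (every element of the index set has only finitely many predecessors). The category $\mathrm{pro}^*\text{-}\mathcal{T}$. Let $\mathcal{T}$ be a category and let $\mathbf{X}=(X_\lambda,p_{\lambda\lambda'},\Lambda)$, $\mathbf{Y}=(Y_\mu,q_{\mu\mu'},M)$ be inverse systems in $\mathcal{T}$. An $S^*$-morphism $(f,f^n_\mu):\mathbf{X}\to\mathbf{Y}$ consists of a function $f:M\to\Lambda$ and $\mathcal{T}$-morphisms $f^n_\mu:X_{f(\mu)}\to Y_\mu$ ($n\in\mathbb{N}$, $\mu\in M$) such that for every related pair $\mu\le\mu'$ in $M$ there exist $\lambda\in\Lambda$, $\lambda\ge f(\mu),f(\mu')$, and $n\in\mathbb{N}$ such that for every $n'\ge n$, $q_{\mu\mu'}f^{n'}_{\mu'}p_{f(\mu')\lambda}=f^{n'}_{\mu}p_{f(\mu)\lambda}$. The composition of $(f,f^n_\mu):\mathbf{X}\to\mathbf{Y}$ and $(g,g^n_\nu):\mathbf{Y}\to\mathbf{Z}$ is $(h,h^n_\nu)$ with $h(\nu)=f(g(\nu))$ and $h^n_\nu=g^n_\nu f^n_{g(\nu)}$; the identity on $\mathbf{X}$ is $(1_\Lambda,1_{X_\lambda})$ (the same for all $n$). Two $S^*$-morphisms $(f,f^n_\mu),(f',f'^n_\mu):\mathbf{X}\to\mathbf{Y}$ are equivalent if for every $\mu\in M$ there are $\lambda\in\Lambda$,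 $\lambda\ge f(\mu),f'(\mu)$, and $n\in\mathbb{N}$ such that $f^{n'}_\mu p_{f(\mu)\lambda}=f'^{n'}_\mu p_{f'(\mu)\lambda}$ for every $n'\ge n$. The category $\mathrm{pro}^*\text{-}\mathcal{T}$ has all inverse systems in $\mathcal{T}$ as objects and equivalence classes $\mathbf{f}^*=[(f,f^n_\mu)]$ of $S^*$-morphisms as morphisms, with composition defined by representatives. Product system and projections. For inverse systems $\mathbf{X},\mathbf{Y}$ in $\mathrm{HTop}$, $\mathbf{X}\times\mathbf{Y}=(X_\lambda\times Y_\mu,\,p_{\lambda\lambda'}\times q_{\mu\mu'},\,\Lambda\times M)$, where $\Lambda\times M$ is directed by $(\lambda,\mu)\le(\lambda',\mu')$ iff $\lambda\le\lambda'$ and $\mu\le\mu'$. For a fixed $\mu\in M$, the index function $\Lambda\to\Lambda\times M$, $\lambda\mapsto(\lambda,\mu)$, together with, for every $n\in\mathbb{N}$ and $\lambda\in\Lambda$, the homotopy class of the projection $X_\lambda\times Y_\mu\to X_\lambda$, is an $S^*$-morphism $\mathbf{X}\times\mathbf{Y}\to\mathbf{X}$; different choices of $\mu$ give equivalent $S^*$-morphisms, and the resulting morphism of $\mathrm{pro}^*\text{-}\mathrm{HTop}$ is denoted $\pi^*_{\mathbf{X}}:\mathbf{X}\times\mathbf{Y}\to\mathbf{X}$. The morphism $\pi^*_{\mathbf{Y}}:\mathbf{X}\times\mathbf{Y}\to\mathbf{Y}$ is defined analogously, by fixing $\lambda\in\Lambda$ and using the projections $X_\lambda\times Y_\mu\to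 Y_\mu$. *)

theory Defs
  imports "HOL-Analysis.Analysis"
begin

section \<open>The homotopy category of spaces\<close>

text \<open>
  A morphism of HTop is a homotopy class of continuous maps, i.e. an element of
  \<open>htop_hom X Y\<close>. A class is a set of total functions on the carrier types; two functions
  that agree on \<open>topspace X\<close> are homotopic, so values outside \<open>topspace X\<close> play no role.
  Compositions and products are formed by taking the class generated by all representatives;
  the lemmas below show that they agree with the usual definitions by representatives.
\<close>

definition htop_rel :: "'a topology \<Rightarrow> 'b topology \<Rightarrow> ('a \<Rightarrow> 'b) rel" where
  "htop_rel X Y = {(f, g). homotopic_with (\<lambda>_. True) X Y f g}"

definition htop_class :: "'a topology \<Rightarrow> 'b topology \<Rightarrow> ('a \<Rightarrow> 'b) \<Rightarrow> ('a \<Rightarrow> 'b) set" where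
  "htop_class X Y f = htop_rel X Y `` {f}"

definition htop_hom :: "'a topology \<Rightarrow> 'b topology \<Rightarrow> ('a \<Rightarrow> 'b) set set" where
  "htop_hom X Y = {f. continuous_map X Y f} // htop_rel X Y"

text \<open>Composition \<open>X \<rightarrow> Y \<rightarrow> Z\<close> is \<open>htop_comp X Z G F\<close>; the middle space is not needed.\<close>

definition htop_comp ::
    "'a topology \<Rightarrow> 'c topology \<Rightarrow> ('b \<Rightarrow> 'c) set \<Rightarrow> ('a \<Rightarrow> 'b) set \<Rightarrow> ('a \<Rightarrow> 'c) set" where
  "htop_comp X Z G F = htop_rel X Z `` {g \<circ> f |f g. f \<in> F \<and> g \<in> G}"

definition htop_prod ::
    "'a topology \<Rightarrow> 'b topology \<Rightarrow> 'c topology \<Rightarrow> 'd topology \<Rightarrow>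
     ('a \<Rightarrow> 'c) set \<Rightarrow> ('b \<Rightarrow> 'd) set \<Rightarrow> ('a \<times> 'b \<Rightarrow> 'c \<times> 'd) set" where
  "htop_prod X Y X' Y' F G =
     htop_rel (prod_topology X Y) (prod_topology X' Y') `` {map_prod f g |f g. f \<in> F \<and> g \<in> G}"

lemma equiv_htop_rel: "equiv {f. continuous_map X Y f} (htop_rel X Y)"
proof (rule equivI)
  show "htop_rel X Y \<subseteq> {f. continuous_map X Y f} \<times> {f. continuous_map X Y f}"
    by (auto simp: htop_rel_def dest: homotopic_with_imp_continuous_maps)
  show "refl_on {f. continuous_map X Y f} (htop_rel X Y)"
    by (auto simp: htop_rel_def refl_on_def)
  show "sym (htop_rel X Y)"
    by (auto simp: htop_rel_def sym_def intro: homotopic_with_symD)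
  show "trans (htop_rel X Y)"
    unfolding htop_rel_def trans_def by (blast intro: homotopic_with_trans)
qed

lemma htop_class_in_hom: "continuous_map X Y f \<Longrightarrow> htop_class X Y f \<in> htop_hom X Y"
  by (auto simp: htop_class_def htop_hom_def intro: quotientI)

lemma htop_homE:
  assumes "F \<in> htop_hom X Y"
  obtains f where "continuous_map X Y f" "F = htop_class X Y f"
  using assms by (auto simp: htop_hom_def htop_class_def elim!: quotientE)

lemma htop_class_eq_iff:
  assumes "continuous_map X Y f" "continuous_map X Y g"
  shows "htop_class X Y f = htop_class X Y g \<longleftrightarrow> homotopic_with (\<lambda>_. True) X Y f g"
  using eq_equiv_class_iff[OF equiv_htop_rel, of f X Y g] assms
  by (simp add: htop_class_def htop_rel_def)

lemma htop_rel_Image_eqI: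
  assumes "f \<in> A" "\<And>g. g \<in> A \<Longrightarrow> homotopic_with (\<lambda>_. True) X Y f g"
  shows "htop_rel X Y `` A = htop_class X Y f"
  using assms
  by (auto simp: htop_rel_def htop_class_def Image_def
      intro: homotopic_with_trans homotopic_with_symD)

lemma mem_htop_class: "g \<in> htop_class X Y f \<longleftrightarrow> homotopic_with (\<lambda>_. True) X Y f g"
  by (simp add: htop_class_def htop_rel_def)

lemma htop_comp_class:
  assumes "continuous_map X Y f" "continuous_map Y Z g"
  shows "htop_comp X Z (htop_class Y Z g) (htop_class X Y f) = htop_class X Z (g \<circ> f)"
  unfolding htop_comp_def
proof (rule htop_rel_Image_eqI)
  show "g \<circ> f \<in> {g' \<circ> f' |f' g'. f' \<in> htop_class X Y f \<and> g' \<in> htop_class Y Z g}"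
    using assms by (force simp: mem_htop_class)
next
  fix k assume "k \<in> {g' \<circ> f' |f' g'. f' \<in> htop_class X Y f \<and> g' \<in> htop_class Y Z g}"
  then obtain f' g' where k: "k = g' \<circ> f'" and f': "homotopic_with (\<lambda>_. True) X Y f f'"
    and g': "homotopic_with (\<lambda>_. True) Y Z g g'"
    by (auto simp: mem_htop_class)
  have "homotopic_with (\<lambda>_. True) X Z (g \<circ> f) (g \<circ> f')"
    by (rule homotopic_with_compose_continuous_map_left[OF f' assms(2)]) simp
  moreover have "homotopic_with (\<lambda>_. True) X Z (g \<circ> f') (g' \<circ> f')"
    using f' by (intro homotopic_with_compose_continuous_map_right[OF g'])
      (auto dest: homotopic_with_imp_continuous_maps)
  ultimately show "homotopic_with (\<lambda>_. True) X Z (g \<circ> f) k"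
    unfolding k by (rule homotopic_with_trans)
qed

lemma htop_comp_in_hom:
  "F \<in> htop_hom X Y \<Longrightarrow> G \<in> htop_hom Y Z \<Longrightarrow> htop_comp X Z G F \<in> htop_hom X Z"
  by (elim htop_homE) (auto simp: htop_comp_class intro: htop_class_in_hom continuous_map_compose)

lemma htop_comp_assoc:
  assumes "F \<in> htop_hom W X" "G \<in> htop_hom X Y" "H \<in> htop_hom Y Z"
  shows "htop_comp W Z (htop_comp X Z H G) F = htop_comp W Z H (htop_comp W Y G F)"
  using assms
  by (elim htop_homE) (simp add: htop_comp_class continuous_map_compose comp_assoc)

lemma htop_comp_id_left: "F \<in> htop_hom X Y \<Longrightarrow> htop_comp X Y (htop_class Y Y id) F = F"
  by (elim htop_homE) (simp add: htop_comp_class)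

lemma htop_comp_id_right: "F \<in> htop_hom X Y \<Longrightarrow> htop_comp X Y F (htop_class X X id) = F"
  by (elim htop_homE) (simp add: htop_comp_class)

lemma htop_prod_class:
  assumes "continuous_map X X' f" "continuous_map Y Y' g"
  shows "htop_prod X Y X' Y' (htop_class X X' f) (htop_class Y Y' g)
    = htop_class (prod_topology X Y) (prod_topology X' Y') (map_prod f g)"
  unfolding htop_prod_def
proof (rule htop_rel_Image_eqI)
  show "map_prod f g \<in> {map_prod f' g' |f' g'. f' \<in> htop_class X X' f \<and> g' \<in> htop_class Y Y' g}"
    using assms by (force simp: mem_htop_class)
next
  fix k assume "k \<in> {map_prod f' g' |f' g'. f' \<in> htop_class X X' f \<and> g' \<in> htop_class Y Y' g}"
  then obtain f' g' where "k = map_prod f' g'" "homotopic_with (\<lambda>_. True) X X' f f'"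
    "homotopic_with (\<lambda>_. True) Y Y' g g'"
    by (auto simp: mem_htop_class)
  then show "homotopic_with (\<lambda>_. True) (prod_topology X Y) (prod_topology X' Y') (map_prod f g) k"
    using homotopic_with_prod_topology[of "\<lambda>_. True" X X' f f' "\<lambda>_. True" Y Y' g g' "\<lambda>_. True"]
    by (simp add: map_prod_def split_def)
qed

section \<open>Inverse systems in HTop\<close>

text \<open>
  \<open>(i, j) \<in> le X\<close> means \<open>i \<le> j\<close>, and \<open>bond X i j\<close> is then the bonding morphism
  from \<open>sp X j\<close> to \<open>sp X i\<close>. The spaces of one system share a point type, which is no
  restriction since topologies may live on arbitrary subsets of it.
\<close>

record ('i, 'a) inv_system =
  idx :: "'i set"
  le :: "'i rel"
  sp :: "'i \<Rightarrow> 'a topology"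
  bond :: "'i \<Rightarrow> 'i \<Rightarrow> ('a \<Rightarrow> 'a) set"

text \<open>A directed set is a nonempty preordered set; antisymmetry is not required.\<close>

definition directed_set :: "'i set \<Rightarrow> 'i rel \<Rightarrow> bool" where
  "directed_set A r \<longleftrightarrow> A \<noteq> {} \<and> preorder_on A r \<and>
     (\<forall>i\<in>A. \<forall>j\<in>A. \<exists>k\<in>A. (i, k) \<in> r \<and> (j, k) \<in> r)"

definition cofinite_set :: "'i set \<Rightarrow> 'i rel \<Rightarrow> bool" where
  "cofinite_set A r \<longleftrightarrow> (\<forall>i\<in>A. finite {j \<in> A. (j, i) \<in> r})"

definition inverse_system :: "('i, 'a) inv_system \<Rightarrow> bool" where
  "inverse_system X \<longleftrightarrow>
     directed_set (idx X) (le X) \<and> cofinite_set (idx X) (le X) \<and>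
     (\<forall>i j. (i, j) \<in> le X \<longrightarrow> bond X i j \<in> htop_hom (sp X j) (sp X i)) \<and>
     (\<forall>i\<in>idx X. bond X i i = htop_class (sp X i) (sp X i) id) \<and>
     (\<forall>i j k. (i, j) \<in> le X \<longrightarrow> (j, k) \<in> le X \<longrightarrow>
        htop_comp (sp X k) (sp X i) (bond X i j) (bond X j k) = bond X i k)"

definition prod_system ::
    "('i, 'a) inv_system \<Rightarrow> ('j, 'b) inv_system \<Rightarrow> ('i \<times> 'j, 'a \<times> 'b) inv_system" where
  "prod_system X Y =
     \<lparr> idx = idx X \<times> idx Y,
       le = {((i, j), (i', j')). (i, i') \<in> le X \<and> (j, j') \<in> le Y},
       sp = (\<lambda>(i, j). prod_topology (sp X i) (sp Y j)),
       bond = (\<lambda>(i, j) (i', j').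
         htop_prod (sp X i') (sp Y j') (sp X i) (sp Y j) (bond X i i') (bond Y j j')) \<rparr>"

lemma
  assumes X: "inverse_system X"
  shows inverse_system_bond: "(i, j) \<in> le X \<Longrightarrow> bond X i j \<in> htop_hom (sp X j) (sp X i)"
    and inverse_system_bond_id: "i \<in> idx X \<Longrightarrow> bond X i i = htop_class (sp X i) (sp X i) id"
    and inverse_system_bond_comp: "(i, j) \<in> le X \<Longrightarrow> (j, k) \<in> le X \<Longrightarrow>
        htop_comp (sp X k) (sp X i) (bond X i j) (bond X j k) = bond X i k"
    and inverse_system_refl: "i \<in> idx X \<Longrightarrow> (i, i) \<in> le X"
    and inverse_system_trans: "(i, j) \<in> le X \<Longrightarrow> (j, k) \<in> le X \<Longrightarrow> (i, k) \<in> le X"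
    and inverse_system_field: "(i, j) \<in> le X \<Longrightarrow> i \<in> idx X \<and> j \<in> idx X"
    and inverse_system_upper: "i \<in> idx X \<Longrightarrow> j \<in> idx X \<Longrightarrow> \<exists>k. (i, k) \<in> le X \<and> (j, k) \<in> le X"
    and inverse_system_nonempty: "idx X \<noteq> {}"
proof -
  have d: "idx X \<noteq> {}" "le X \<subseteq> idx X \<times> idx X" "refl_on (idx X) (le X)" "trans (le X)"
    "\<And>i j. i \<in> idx X \<Longrightarrow> j \<in> idx X \<Longrightarrow> \<exists>k\<in>idx X. (i, k) \<in> le X \<and> (j, k) \<in> le X"
    using X by (auto simp: inverse_system_def directed_set_def preorder_on_def)
  show "(i, j) \<in> le X \<Longrightarrow> bond X i j \<in> htop_hom (sp X j) (sp X i)"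
    "i \<in> idx X \<Longrightarrow> bond X i i = htop_class (sp X i) (sp X i) id"
    "(i, j) \<in> le X \<Longrightarrow> (j, k) \<in> le X \<Longrightarrow>
        htop_comp (sp X k) (sp X i) (bond X i j) (bond X j k) = bond X i k"
    using X by (auto simp: inverse_system_def)
  show "i \<in> idx X \<Longrightarrow> (i, i) \<in> le X" using d(3) by (rule refl_onD)
  show "(i, j) \<in> le X \<Longrightarrow> (j, k) \<in> le X \<Longrightarrow> (i, k) \<in> le X" using d(4) by (rule transD)
  show "(i, j) \<in> le X \<Longrightarrow> i \<in> idx X \<and> j \<in> idx X" using d(2) by blast
  show "i \<in> idx X \<Longrightarrow> j \<in> idx X \<Longrightarrow> \<exists>k. (i, k) \<in> le X \<and> (j, k) \<in> le X" using d(5) by blast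
  show "idx X \<noteq> {}" by (rule d(1))
qed

lemma continuous_map_map_prod:
  assumes "continuous_map A C f" "continuous_map B D g"
  shows "continuous_map (prod_topology A B) (prod_topology C D) (map_prod f g)"
proof -
  have "continuous_map (prod_topology A B) C (f \<circ> fst)" "continuous_map (prod_topology A B) D (g \<circ> snd)"
    by (rule continuous_map_compose[OF _ assms(1)] continuous_map_compose[OF _ assms(2)];
        rule continuous_map_fst continuous_map_snd)+
  moreover have "fst \<circ> map_prod f g = f \<circ> fst" "snd \<circ> map_prod f g = g \<circ> snd"
    by auto
  ultimately show ?thesis
    unfolding continuous_map_pairwise by metis
qed

lemma htop_prod_in_hom:
  "F \<in> htop_hom X X' \<Longrightarrow> G \<in> htop_hom Y Y' \<Longrightarrow>
   htop_prod X Y X' Y' F G \<in> htop_hom (prod_topology X Y) (prod_topology X' Y')"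
  by (elim htop_homE)
    (auto simp: htop_prod_class intro!: htop_class_in_hom continuous_map_map_prod)

lemma htop_prod_comp:
  assumes "F \<in> htop_hom X X'" "G \<in> htop_hom Y Y'" "F' \<in> htop_hom X' X''" "G' \<in> htop_hom Y' Y''"
  shows "htop_comp (prod_topology X Y) (prod_topology X'' Y'')
      (htop_prod X' Y' X'' Y'' F' G') (htop_prod X Y X' Y' F G)
    = htop_prod X Y X'' Y'' (htop_comp X X'' F' F) (htop_comp Y Y'' G' G)"
proof -
  obtain f g f' g' where fg: "continuous_map X X' f" "F = htop_class X X' f"
      "continuous_map Y Y' g" "G = htop_class Y Y' g"
      "continuous_map X' X'' f'" "F' = htop_class X' X'' f'"
      "continuous_map Y' Y'' g'" "G' = htop_class Y' Y'' g'"
    using assms by (meson htop_homE)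
  have "map_prod f' g' \<circ> map_prod f g = map_prod (f' \<circ> f) (g' \<circ> g)"
    by auto
  with fg show ?thesis
    by (simp add: htop_prod_class htop_comp_class continuous_map_compose continuous_map_map_prod)
qed

lemma inverse_system_prod_system:
  assumes X: "inverse_system X" and Y: "inverse_system Y"
  shows "inverse_system (prod_system X Y)"
proof -
  note facts = inverse_system_bond[OF X] inverse_system_bond[OF Y]
    inverse_system_bond_id[OF X] inverse_system_bond_id[OF Y]
    inverse_system_bond_comp[OF X] inverse_system_bond_comp[OF Y]
  have "directed_set (idx (prod_system X Y)) (le (prod_system X Y))"
    unfolding directed_set_def preorder_on_def refl_on_def
  proof (intro conjI)
    show "trans (le (prod_system X Y))"
      by (auto simp: prod_system_def trans_def intro: inverse_system_trans[OF X] inverse_system_trans[OF Y])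
  next
    show "\<forall>i\<in>idx (prod_system X Y). \<forall>j\<in>idx (prod_system X Y). \<exists>k\<in>idx (prod_system X Y).
        (i, k) \<in> le (prod_system X Y) \<and> (j, k) \<in> le (prod_system X Y)"
    proof (intro ballI)
      fix p q assume "p \<in> idx (prod_system X Y)" "q \<in> idx (prod_system X Y)"
      then obtain a b c d where pq: "p = (a, b)" "q = (c, d)"
        and "a \<in> idx X" "b \<in> idx Y" "c \<in> idx X" "d \<in> idx Y"
        by (auto simp: prod_system_def)
      then obtain u v where "(a, u) \<in> le X" "(c, u) \<in> le X" "(b, v) \<in> le Y" "(d, v) \<in> le Y"
        using inverse_system_upper[OF X] inverse_system_upper[OF Y] by metis
      then show "\<exists>k\<in>idx (prod_system X Y).
          (p, k) \<in> le (prod_system X Y) \<and> (q, k) \<in> le (prod_system X Y)"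
        using inverse_system_field[OF X] inverse_system_field[OF Y]
        by (intro bexI[of _ "(u, v)"]) (auto simp: prod_system_def pq)
    qed
  next
    show "idx (prod_system X Y) \<noteq> {}"
      using inverse_system_nonempty[OF X] inverse_system_nonempty[OF Y] by (simp add: prod_system_def)
    show "le (prod_system X Y) \<subseteq> idx (prod_system X Y) \<times> idx (prod_system X Y)"
      using inverse_system_field[OF X] inverse_system_field[OF Y] by (force simp: prod_system_def)
    show "\<forall>p\<in>idx (prod_system X Y). (p, p) \<in> le (prod_system X Y)"
      using inverse_system_refl[OF X] inverse_system_refl[OF Y] by (auto simp: prod_system_def)
  qed
  moreover have "cofinite_set (idx (prod_system X Y)) (le (prod_system X Y))"
    unfolding cofinite_set_def
  proof
    fix p assume p: "p \<in> idx (prod_system X Y)"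
    obtain i j where ij: "p = (i, j)" by fastforce
    have "finite ({k \<in> idx X. (k, i) \<in> le X} \<times> {k \<in> idx Y. (k, j) \<in> le Y})"
      using X Y p by (auto simp: ij inverse_system_def cofinite_set_def prod_system_def)
    then show "finite {q \<in> idx (prod_system X Y). (q, p) \<in> le (prod_system X Y)}"
      by (rule rev_finite_subset) (auto simp: ij prod_system_def)
  qed
  moreover have "\<forall>p q. (p, q) \<in> le (prod_system X Y) \<longrightarrow>
      bond (prod_system X Y) p q \<in> htop_hom (sp (prod_system X Y) q) (sp (prod_system X Y) p)"
    by (auto simp: prod_system_def intro!: htop_prod_in_hom facts)
  moreover have "\<forall>p\<in>idx (prod_system X Y). bond (prod_system X Y) p p
      = htop_class (sp (prod_system X Y) p) (sp (prod_system X Y) p) id"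
    by (auto simp: prod_system_def facts htop_prod_class map_prod.id)
  moreover have "\<forall>p q r. (p, q) \<in> le (prod_system X Y) \<longrightarrow> (q, r) \<in> le (prod_system X Y) \<longrightarrow>
      htop_comp (sp (prod_system X Y) r) (sp (prod_system X Y) p)
        (bond (prod_system X Y) p q) (bond (prod_system X Y) q r) = bond (prod_system X Y) p r"
    by (auto simp: prod_system_def facts htop_prod_comp)
  ultimately show ?thesis unfolding inverse_system_def by blast
qed

section \<open>The category pro*-HTop\<close>

text \<open>A candidate \<open>(f, F)\<close> has index function \<open>f\<close> and level morphisms \<open>F n m\<close>; values at indices
  outside \<open>idx Y\<close> are irrelevant, as they are ignored by \<open>s_equiv\<close>.\<close>

type_synonym ('i, 'a, 'j, 'b) s_data = "('j \<Rightarrow> 'i) \<times> (nat \<Rightarrow> 'j \<Rightarrow> ('a \<Rightarrow> 'b) set)"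

definition s_mor ::
    "('i, 'a) inv_system \<Rightarrow> ('j, 'b) inv_system \<Rightarrow> ('i, 'a, 'j, 'b) s_data set" where
  "s_mor X Y = {(f, F).
     f \<in> idx Y \<rightarrow> idx X \<and>
     (\<forall>n. \<forall>m\<in>idx Y. F n m \<in> htop_hom (sp X (f m)) (sp Y m)) \<and>
     (\<forall>m m'. (m, m') \<in> le Y \<longrightarrow>
        (\<exists>l n. (f m, l) \<in> le X \<and> (f m', l) \<in> le X \<and>
           (\<forall>n'\<ge>n.
              htop_comp (sp X l) (sp Y m) (bond Y m m')
                (htop_comp (sp X l) (sp Y m') (F n' m') (bond X (f m') l))
              = htop_comp (sp X l) (sp Y m) (F n' m) (bond X (f m) l))))}"

definition s_equiv ::
    "('i, 'a) inv_system \<Rightarrow> ('j, 'b) inv_system \<Rightarrow> ('i, 'a, 'j, 'b) s_data rel" where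
  "s_equiv X Y = {((f, F), (f', F')).
     (f, F) \<in> s_mor X Y \<and> (f', F') \<in> s_mor X Y \<and>
     (\<forall>m\<in>idx Y. \<exists>l n. (f m, l) \<in> le X \<and> (f' m, l) \<in> le X \<and>
        (\<forall>n'\<ge>n. htop_comp (sp X l) (sp Y m) (F n' m) (bond X (f m) l)
               = htop_comp (sp X l) (sp Y m) (F' n' m) (bond X (f' m) l)))}"

definition s_comp ::
    "('i, 'a) inv_system \<Rightarrow> ('k, 'c) inv_system \<Rightarrow>
     ('j, 'b, 'k, 'c) s_data \<Rightarrow> ('i, 'a, 'j, 'b) s_data \<Rightarrow> ('i, 'a, 'k, 'c) s_data" where
  "s_comp X Z = (\<lambda>(g, G) (f, F).
     (f \<circ> g, \<lambda>n k. htop_comp (sp X (f (g k))) (sp Z k) (G n k) (F n (g k))))"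

definition pro_class ::
    "('i, 'a) inv_system \<Rightarrow> ('j, 'b) inv_system \<Rightarrow>
     ('i, 'a, 'j, 'b) s_data \<Rightarrow> ('i, 'a, 'j, 'b) s_data set" where
  "pro_class X Y s = s_equiv X Y `` {s}"

definition pro_hom ::
    "('i, 'a) inv_system \<Rightarrow> ('j, 'b) inv_system \<Rightarrow> ('i, 'a, 'j, 'b) s_data set set" where
  "pro_hom X Y = s_mor X Y // s_equiv X Y"

text \<open>\<open>pro_comp_class\<close> below shows that this is composition by representatives.\<close>

definition pro_comp ::
    "('i, 'a) inv_system \<Rightarrow> ('k, 'c) inv_system \<Rightarrow>
     ('j, 'b, 'k, 'c) s_data set \<Rightarrow> ('i, 'a, 'j, 'b) s_data set \<Rightarrow> ('i, 'a, 'k, 'c) s_data set" where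
  "pro_comp X Z g f = s_equiv X Z `` {s_comp X Z t s |s t. s \<in> f \<and> t \<in> g}"

lemma s_level_comp:
  assumes X: "inverse_system X" and "(i, l) \<in> le X" "(l, l') \<in> le X" "F \<in> htop_hom (sp X i) Y"
  shows "htop_comp (sp X l') Y F (bond X i l')
    = htop_comp (sp X l') Y (htop_comp (sp X l) Y F (bond X i l)) (bond X l l')"
  using assms inverse_system_bond[OF X] inverse_system_bond_comp[OF X, of i l l']
  by (subst htop_comp_assoc) auto

lemma equiv_s_equiv:
  assumes X: "inverse_system X"
  shows "equiv (s_mor X Y) (s_equiv X Y)"
proof (rule equivI)
  show "s_equiv X Y \<subseteq> s_mor X Y \<times> s_mor X Y"
    by (auto simp: s_equiv_def)
  show "refl_on (s_mor X Y) (s_equiv X Y)"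
    unfolding refl_on_def
  proof
    fix s assume s: "s \<in> s_mor X Y"
    then show "(s, s) \<in> s_equiv X Y"
      using inverse_system_refl[OF X]
      by (cases s) (fastforce simp: s_equiv_def s_mor_def Pi_iff)
  qed
  show "sym (s_equiv X Y)"
    by (rule symI) (fastforce simp: s_equiv_def)
  show "trans (s_equiv X Y)"
  proof (rule transI)
    fix s t u assume st: "(s, t) \<in> s_equiv X Y" and tu: "(t, u) \<in> s_equiv X Y"
    obtain f F g G h H where eq: "s = (f, F)" "t = (g, G)" "u = (h, H)"
      by (metis surj_pair)
    have "\<exists>l n. (f m, l) \<in> le X \<and> (h m, l) \<in> le X \<and>
        (\<forall>n'\<ge>n. htop_comp (sp X l) (sp Y m) (F n' m) (bond X (f m) l)
               = htop_comp (sp X l) (sp Y m) (H n' m) (bond X (h m) l))" if m: "m \<in> idx Y" for m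
    proof -
      obtain l1 n1 where 1: "(f m, l1) \<in> le X" "(g m, l1) \<in> le X"
        "\<And>n'. n' \<ge> n1 \<Longrightarrow> htop_comp (sp X l1) (sp Y m) (F n' m) (bond X (f m) l1)
               = htop_comp (sp X l1) (sp Y m) (G n' m) (bond X (g m) l1)"
        using st m by (auto simp: s_equiv_def eq) blast
      obtain l2 n2 where 2: "(g m, l2) \<in> le X" "(h m, l2) \<in> le X"
        "\<And>n'. n' \<ge> n2 \<Longrightarrow> htop_comp (sp X l2) (sp Y m) (G n' m) (bond X (g m) l2)
               = htop_comp (sp X l2) (sp Y m) (H n' m) (bond X (h m) l2)"
        using tu m by (auto simp: s_equiv_def eq) blast
      obtain l where l: "(l1, l) \<in> le X" "(l2, l) \<in> le X"
        using inverse_system_upper[OF X] inverse_system_field[OF X] 1(1) 2(1) by meson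
      have hom: "F n m \<in> htop_hom (sp X (f m)) (sp Y m)" "G n m \<in> htop_hom (sp X (g m)) (sp Y m)"
        "H n m \<in> htop_hom (sp X (h m)) (sp Y m)" for n
        using st tu m by (auto simp: s_equiv_def s_mor_def eq)
      have "htop_comp (sp X l) (sp Y m) (F n m) (bond X (f m) l)
          = htop_comp (sp X l) (sp Y m) (H n m) (bond X (h m) l)" if "n \<ge> max n1 n2" for n
      proof -
        have "htop_comp (sp X l) (sp Y m) (F n m) (bond X (f m) l)
            = htop_comp (sp X l) (sp Y m) (G n m) (bond X (g m) l)"
          using that by (simp add: s_level_comp[OF X 1(1) l(1) hom(1)] s_level_comp[OF X 1(2) l(1) hom(2)] 1(3))
        also have "\<dots> = htop_comp (sp X l) (sp Y m) (H n m) (bond X (h m) l)"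
          using that by (simp add: s_level_comp[OF X 2(1) l(2) hom(2)] s_level_comp[OF X 2(2) l(2) hom(3)] 2(3))
        finally show ?thesis .
      qed
      then show ?thesis
        using inverse_system_trans[OF X] 1(1) 2(2) l by blast
    qed
    then show "(s, u) \<in> s_equiv X Y"
      using st tu by (simp add: s_equiv_def eq)
  qed
qed

lemma s_comp_in_s_mor:
  assumes X: "inverse_system X" and Y: "inverse_system Y" and Z: "inverse_system Z"
    and s: "s \<in> s_mor X Y" and t: "t \<in> s_mor Y Z"
  shows "s_comp X Z t s \<in> s_mor X Z"
proof -
  obtain f F g G where eq: "s = (f, F)" "t = (g, G)" by (metis surj_pair)
  have f: "\<And>m. m \<in> idx Y \<Longrightarrow> f m \<in> idx X" and g: "\<And>k. k \<in> idx Z \<Longrightarrow> g k \<in> idx Y"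
    and F: "\<And>n m. m \<in> idx Y \<Longrightarrow> F n m \<in> htop_hom (sp X (f m)) (sp Y m)"
    and G: "\<And>n k. k \<in> idx Z \<Longrightarrow> G n k \<in> htop_hom (sp Y (g k)) (sp Z k)"
    using s t by (auto simp: s_mor_def eq)
  have Fc: "\<exists>l n. (f m, l) \<in> le X \<and> (f m', l) \<in> le X \<and>
           (\<forall>n'\<ge>n.
              htop_comp (sp X l) (sp Y m) (bond Y m m')
                (htop_comp (sp X l) (sp Y m') (F n' m') (bond X (f m') l))
              = htop_comp (sp X l) (sp Y m) (F n' m) (bond X (f m) l))"
    if "(m, m') \<in> le Y" for m m'
    using s that by (auto simp: s_mor_def eq)
  have Gc: "\<exists>l n. (g m, l) \<in> le Y \<and> (g m', l) \<in> le Y \<and>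
           (\<forall>n'\<ge>n.
              htop_comp (sp Y l) (sp Z m) (bond Z m m')
                (htop_comp (sp Y l) (sp Z m') (G n' m') (bond Y (g m') l))
              = htop_comp (sp Y l) (sp Z m) (G n' m) (bond Y (g m) l))"
    if "(m, m') \<in> le Z" for m m'
    using t that by (auto simp: s_mor_def eq)
  define H where "H = (\<lambda>n k. htop_comp (sp X (f (g k))) (sp Z k) (G n k) (F n (g k)))"
  have H: "H n k \<in> htop_hom (sp X (f (g k))) (sp Z k)" if "k \<in> idx Z" for n k
    unfolding H_def using that F G g by (blast intro: htop_comp_in_hom)
  have "\<exists>l n. (f (g k), l) \<in> le X \<and> (f (g k'), l) \<in> le X \<and>
           (\<forall>n'\<ge>n.
              htop_comp (sp X l) (sp Z k) (bond Z k k')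
                (htop_comp (sp X l) (sp Z k') (H n' k') (bond X (f (g k')) l))
              = htop_comp (sp X l) (sp Z k) (H n' k) (bond X (f (g k)) l))"
    if kk': "(k, k') \<in> le Z" for k k'
  proof -
    have k: "k \<in> idx Z" "k' \<in> idx Z" using inverse_system_field[OF Z kk'] by auto
    obtain m n0 where m: "(g k, m) \<in> le Y" "(g k', m) \<in> le Y" and
      Gm: "\<And>n'. n' \<ge> n0 \<Longrightarrow> htop_comp (sp Y m) (sp Z k) (bond Z k k')
                (htop_comp (sp Y m) (sp Z k') (G n' k') (bond Y (g k') m))
              = htop_comp (sp Y m) (sp Z k) (G n' k) (bond Y (g k) m)"
      using Gc[OF kk'] by blast
    have mY: "m \<in> idx Y" using inverse_system_field[OF Y m(1)] by auto
    obtain l1 n1 where l1: "(f (g k), l1) \<in> le X" "(f m, l1) \<in> le X" and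
      F1: "\<And>n'. n' \<ge> n1 \<Longrightarrow> htop_comp (sp X l1) (sp Y (g k)) (bond Y (g k) m)
                (htop_comp (sp X l1) (sp Y m) (F n' m) (bond X (f m) l1))
              = htop_comp (sp X l1) (sp Y (g k)) (F n' (g k)) (bond X (f (g k)) l1)"
      using Fc[OF m(1)] by blast
    obtain l2 n2 where l2: "(f (g k'), l2) \<in> le X" "(f m, l2) \<in> le X" and
      F2: "\<And>n'. n' \<ge> n2 \<Longrightarrow> htop_comp (sp X l2) (sp Y (g k')) (bond Y (g k') m)
                (htop_comp (sp X l2) (sp Y m) (F n' m) (bond X (f m) l2))
              = htop_comp (sp X l2) (sp Y (g k')) (F n' (g k')) (bond X (f (g k')) l2)"
      using Fc[OF m(2)] by blast
    obtain l where l: "(l1, l) \<in> le X" "(l2, l) \<in> le X"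
      using inverse_system_upper[OF X] inverse_system_field[OF X] l1(1) l2(1) by meson
    have fl: "(f (g k), l) \<in> le X" "(f (g k'), l) \<in> le X" "(f m, l) \<in> le X"
      using inverse_system_trans[OF X] l1 l2 l by blast+
    note bX = inverse_system_bond[OF X] and bY = inverse_system_bond[OF Y] and bZ = inverse_system_bond[OF Z]
    have up: "htop_comp (sp X l) (sp Y i) (bond Y i m) (htop_comp (sp X l) (sp Y m) (F n m) (bond X (f m) l))
         = htop_comp (sp X l) (sp Y i) (F n i) (bond X (f i) l)"
      if "(i, m) \<in> le Y" and li: "(f i, l') \<in> le X" "(f m, l') \<in> le X" "(l', l) \<in> le X" and
       e: "htop_comp (sp X l') (sp Y i) (bond Y i m)
                (htop_comp (sp X l') (sp Y m) (F n m) (bond X (f m) l'))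
              = htop_comp (sp X l') (sp Y i) (F n i) (bond X (f i) l')" for i l' n
    proof -
      have i: "i \<in> idx Y" using inverse_system_field[OF Y that(1)] by simp
      show ?thesis
        unfolding s_level_comp[OF X li(1,3) F[OF i]] s_level_comp[OF X li(2,3) F[OF mY]] e[symmetric]
        by (rule htop_comp_assoc[symmetric])
          (use that F[OF mY] in \<open>auto intro: bX bY htop_comp_in_hom\<close>)
    qed
    have "htop_comp (sp X l) (sp Z k) (bond Z k k')
                (htop_comp (sp X l) (sp Z k') (H n k') (bond X (f (g k')) l))
              = htop_comp (sp X l) (sp Z k) (H n k) (bond X (f (g k)) l)"
      if n: "n \<ge> max n0 (max n1 n2)" for n
    proof -
      let ?w = "htop_comp (sp X l) (sp Y m) (F n m) (bond X (f m) l)"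
      have w: "?w \<in> htop_hom (sp X l) (sp Y m)" using F[OF mY] bX fl by (blast intro: htop_comp_in_hom)
      have *: "htop_comp (sp X l) (sp Z i) (H n i) (bond X (f (g i)) l)
        = htop_comp (sp X l) (sp Z i) (htop_comp (sp Y m) (sp Z i) (G n i) (bond Y (g i) m)) ?w"
        if i: "i \<in> idx Z" "(g i, m) \<in> le Y" "(f (g i), l) \<in> le X" and
          e: "htop_comp (sp X l) (sp Y (g i)) (bond Y (g i) m) ?w
            = htop_comp (sp X l) (sp Y (g i)) (F n (g i)) (bond X (f (g i)) l)" for i
      proof -
        have "htop_comp (sp X l) (sp Z i) (H n i) (bond X (f (g i)) l)
           = htop_comp (sp X l) (sp Z i) (G n i)
              (htop_comp (sp X l) (sp Y (g i)) (F n (g i)) (bond X (f (g i)) l))"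
          unfolding H_def by (rule htop_comp_assoc) (use i F G g bX in auto)
        also have "\<dots> = htop_comp (sp X l) (sp Z i) (htop_comp (sp Y m) (sp Z i) (G n i) (bond Y (g i) m)) ?w"
          unfolding e[symmetric] by (rule htop_comp_assoc[symmetric]) (use i G bY w in auto)
        finally show ?thesis .
      qed
      have 1: "htop_comp (sp X l) (sp Z k) (H n k) (bond X (f (g k)) l)
        = htop_comp (sp X l) (sp Z k) (htop_comp (sp Y m) (sp Z k) (G n k) (bond Y (g k) m)) ?w"
        by (rule *[OF k(1) m(1) fl(1) up[OF m(1) l1 l(1) F1]]) (use n in auto)
      have 2: "htop_comp (sp X l) (sp Z k') (H n k') (bond X (f (g k')) l)
        = htop_comp (sp X l) (sp Z k') (htop_comp (sp Y m) (sp Z k') (G n k') (bond Y (g k') m)) ?w"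
        by (rule *[OF k(2) m(2) fl(2) up[OF m(2) l2 l(2) F2]]) (use n in auto)
      have 3: "htop_comp (sp Y m) (sp Z k) (bond Z k k')
                (htop_comp (sp Y m) (sp Z k') (G n k') (bond Y (g k') m))
              = htop_comp (sp Y m) (sp Z k) (G n k) (bond Y (g k) m)"
        using Gm n by simp
      show ?thesis
        unfolding 1 2 3[symmetric]
        by (rule htop_comp_assoc[symmetric])
          (use w G[OF k(2)] bY[OF m(2)] bZ[OF kk'] in \<open>auto intro: htop_comp_in_hom\<close>)
    qed
    then show ?thesis using fl by blast
  qed
  then show ?thesis
    using f g H by (auto simp: s_comp_def eq s_mor_def H_def[symmetric] Pi_iff)
qed

lemma s_comp_cong:
  assumes X: "inverse_system X" and Y: "inverse_system Y" and Z: "inverse_system Z"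
    and ss: "(s, s') \<in> s_equiv X Y" and tt: "(t, t') \<in> s_equiv Y Z"
  shows "(s_comp X Z t s, s_comp X Z t' s') \<in> s_equiv X Z"
proof -
  obtain f F g G f' F' g' G' where eq: "s = (f, F)" "t = (g, G)" "s' = (f', F')" "t' = (g', G')"
    by (metis surj_pair)
  have mor: "s \<in> s_mor X Y" "s' \<in> s_mor X Y" "t \<in> s_mor Y Z" "t' \<in> s_mor Y Z"
    using ss tt by (auto simp: s_equiv_def)
  have g: "g k \<in> idx Y" "g' k \<in> idx Y" if "k \<in> idx Z" for k
    using mor that by (auto simp: s_mor_def eq)
  have F: "F n m \<in> htop_hom (sp X (f m)) (sp Y m)" "F' n m \<in> htop_hom (sp X (f' m)) (sp Y m)"
    if "m \<in> idx Y" for n m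
    using mor that by (auto simp: s_mor_def eq)
  have G: "G n k \<in> htop_hom (sp Y (g k)) (sp Z k)" "G' n k \<in> htop_hom (sp Y (g' k)) (sp Z k)"
    if "k \<in> idx Z" for n k
    using mor that by (auto simp: s_mor_def eq)
  note bX = inverse_system_bond[OF X] and bY = inverse_system_bond[OF Y]
  have coh: "\<exists>l n. (a i, l) \<in> le X \<and> (a m, l) \<in> le X \<and> (\<forall>l' n'. (l, l') \<in> le X \<longrightarrow> n \<le> n' \<longrightarrow>
         htop_comp (sp X l') (sp Y i) (A n' i) (bond X (a i) l')
         = htop_comp (sp X l') (sp Y i) (bond Y i m) (htop_comp (sp X l') (sp Y m) (A n' m) (bond X (a m) l')))"
    if aA: "(a, A) \<in> s_mor X Y" and im: "(i, m) \<in> le Y" for a A i m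
  proof -
    obtain l n where l: "(a i, l) \<in> le X" "(a m, l) \<in> le X" and
      e: "\<And>n'. n \<le> n' \<Longrightarrow> htop_comp (sp X l) (sp Y i) (bond Y i m)
                (htop_comp (sp X l) (sp Y m) (A n' m) (bond X (a m) l))
              = htop_comp (sp X l) (sp Y i) (A n' i) (bond X (a i) l)"
      using aA im by (auto simp: s_mor_def) blast
    have i: "i \<in> idx Y" "m \<in> idx Y" using inverse_system_field[OF Y im] by auto
    have A: "A n j \<in> htop_hom (sp X (a j)) (sp Y j)" if "j \<in> idx Y" for n j
      using aA that by (auto simp: s_mor_def)
    have "htop_comp (sp X l') (sp Y i) (A n' i) (bond X (a i) l')
         = htop_comp (sp X l') (sp Y i) (bond Y i m) (htop_comp (sp X l') (sp Y m) (A n' m) (bond X (a m) l'))"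
      if l': "(l, l') \<in> le X" and n: "n \<le> n'" for l' n'
      unfolding s_level_comp[OF X l(1) l' A[OF i(1)]] s_level_comp[OF X l(2) l' A[OF i(2)]] e[OF n, symmetric]
      by (rule htop_comp_assoc) (use A[OF i(2)] im l l' in \<open>auto intro: bX bY htop_comp_in_hom\<close>)
    then show ?thesis using l by blast
  qed
  have "\<exists>l n. (f (g k), l) \<in> le X \<and> (f' (g' k), l) \<in> le X \<and>
      (\<forall>n'\<ge>n. htop_comp (sp X l) (sp Z k) (htop_comp (sp X (f (g k))) (sp Z k) (G n' k) (F n' (g k))) (bond X (f (g k)) l)
         = htop_comp (sp X l) (sp Z k) (htop_comp (sp X (f' (g' k))) (sp Z k) (G' n' k) (F' n' (g' k))) (bond X (f' (g' k)) l))"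
    if k: "k \<in> idx Z" for k
  proof -
    obtain m n0 where m: "(g k, m) \<in> le Y" "(g' k, m) \<in> le Y" and
      e0: "\<And>n'. n0 \<le> n' \<Longrightarrow> htop_comp (sp Y m) (sp Z k) (G n' k) (bond Y (g k) m)
               = htop_comp (sp Y m) (sp Z k) (G' n' k) (bond Y (g' k) m)"
      using tt k by (auto simp: s_equiv_def eq) blast
    have mY: "m \<in> idx Y" using inverse_system_field[OF Y m(1)] by auto
    obtain l1 n1 where l1: "(f (g k), l1) \<in> le X" "(f m, l1) \<in> le X" and
      e1: "\<And>l' n'. (l1, l') \<in> le X \<Longrightarrow> n1 \<le> n' \<Longrightarrow>
         htop_comp (sp X l') (sp Y (g k)) (F n' (g k)) (bond X (f (g k)) l')
         = htop_comp (sp X l') (sp Y (g k)) (bond Y (g k) m) (htop_comp (sp X l') (sp Y m) (F n' m) (bond X (f m) l'))"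
      using coh[of f F, OF _ m(1)] mor(1) unfolding eq by blast
    obtain l2 n2 where l2: "(f' (g' k), l2) \<in> le X" "(f' m, l2) \<in> le X" and
      e2: "\<And>l' n'. (l2, l') \<in> le X \<Longrightarrow> n2 \<le> n' \<Longrightarrow>
         htop_comp (sp X l') (sp Y (g' k)) (F' n' (g' k)) (bond X (f' (g' k)) l')
         = htop_comp (sp X l') (sp Y (g' k)) (bond Y (g' k) m) (htop_comp (sp X l') (sp Y m) (F' n' m) (bond X (f' m) l'))"
      using coh[of f' F', OF _ m(2)] mor(2) unfolding eq by blast
    obtain l3 n3 where l3: "(f m, l3) \<in> le X" "(f' m, l3) \<in> le X" and
      e3: "\<And>n'. n3 \<le> n' \<Longrightarrow> htop_comp (sp X l3) (sp Y m) (F n' m) (bond X (f m) l3)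
               = htop_comp (sp X l3) (sp Y m) (F' n' m) (bond X (f' m) l3)"
      using ss mY by (auto simp: s_equiv_def eq) blast
    obtain l where l: "(l1, l) \<in> le X" "(l2, l) \<in> le X" "(l3, l) \<in> le X"
    proof -
      obtain l0 where l0: "(l1, l0) \<in> le X" "(l2, l0) \<in> le X"
        using inverse_system_upper[OF X] inverse_system_field[OF X] l1(1) l2(1) by meson
      obtain l where "(l0, l) \<in> le X" "(l3, l) \<in> le X"
        using inverse_system_upper[OF X] inverse_system_field[OF X] l0(1) l3(1) by meson
      then show thesis using l0 inverse_system_trans[OF X] that by blast
    qed
    have fl: "(f (g k), l) \<in> le X" "(f' (g' k), l) \<in> le X" "(f m, l) \<in> le X" "(f' m, l) \<in> le X"
      using inverse_system_trans[OF X] l1 l2 l by blast+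
    have "htop_comp (sp X l) (sp Z k) (htop_comp (sp X (f (g k))) (sp Z k) (G n k) (F n (g k))) (bond X (f (g k)) l)
         = htop_comp (sp X l) (sp Z k) (htop_comp (sp X (f' (g' k))) (sp Z k) (G' n k) (F' n (g' k))) (bond X (f' (g' k)) l)"
      if n: "n \<ge> max (max n0 n1) (max n2 n3)" for n
    proof -
      have w: "htop_comp (sp X l) (sp Y m) (F n m) (bond X (f m) l)
             = htop_comp (sp X l) (sp Y m) (F' n m) (bond X (f' m) l)"
        unfolding s_level_comp[OF X l3(1) l(3) F(1)[OF mY]] s_level_comp[OF X l3(2) l(3) F(2)[OF mY]]
        using e3 n by simp
      let ?w = "htop_comp (sp X l) (sp Y m) (F n m) (bond X (f m) l)"
      have wh: "?w \<in> htop_hom (sp X l) (sp Y m)" using F[OF mY] bX fl by (blast intro: htop_comp_in_hom)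
      have "htop_comp (sp X l) (sp Z k) (htop_comp (sp X (f (g k))) (sp Z k) (G n k) (F n (g k))) (bond X (f (g k)) l)
         = htop_comp (sp X l) (sp Z k) (G n k) (htop_comp (sp X l) (sp Y (g k)) (F n (g k)) (bond X (f (g k)) l))"
        by (rule htop_comp_assoc[OF bX[OF fl(1)] F(1)[OF g(1)[OF k]] G(1)[OF k]])
      also have "\<dots> = htop_comp (sp X l) (sp Z k) (G n k) (htop_comp (sp X l) (sp Y (g k)) (bond Y (g k) m) ?w)"
        using e1[OF l(1), of n] n by simp
      also have "\<dots> = htop_comp (sp X l) (sp Z k) (htop_comp (sp Y m) (sp Z k) (G n k) (bond Y (g k) m)) ?w"
        by (rule htop_comp_assoc[symmetric]) (use G k m bY wh in auto)
      also have "\<dots> = htop_comp (sp X l) (sp Z k) (htop_comp (sp Y m) (sp Z k) (G' n k) (bond Y (g' k) m)) ?w"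
        using e0 n by simp
      also have "\<dots> = htop_comp (sp X l) (sp Z k) (G' n k) (htop_comp (sp X l) (sp Y (g' k)) (bond Y (g' k) m) ?w)"
        by (rule htop_comp_assoc) (use G k m bY wh in auto)
      also have "\<dots> = htop_comp (sp X l) (sp Z k) (htop_comp (sp X (f' (g' k))) (sp Z k) (G' n k) (F' n (g' k))) (bond X (f' (g' k)) l)"
        unfolding w htop_comp_assoc[OF bX[OF fl(2)] F(2)[OF g(2)[OF k]] G(2)[OF k]]
        using e2[OF l(2), of n] n by simp
      finally show ?thesis .
    qed
    then show ?thesis using fl by blast
  qed
  moreover have "s_comp X Z t s \<in> s_mor X Z" "s_comp X Z t' s' \<in> s_mor X Z"
    using s_comp_in_s_mor[OF X Y Z] mor by auto
  ultimately show ?thesis by (simp add: s_equiv_def s_comp_def eq)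
qed

lemma pro_comp_class:
  assumes X: "inverse_system X" and Y: "inverse_system Y" and Z: "inverse_system Z"
    and s: "s \<in> s_mor X Y" and t: "t \<in> s_mor Y Z"
  shows "pro_comp X Z (pro_class Y Z t) (pro_class X Y s) = pro_class X Z (s_comp X Z t s)"
proof
  have "trans (s_equiv X Z)"
    using equiv_s_equiv[OF X] by (rule equivE)
  then show "pro_comp X Z (pro_class Y Z t) (pro_class X Y s) \<subseteq> pro_class X Z (s_comp X Z t s)"
    unfolding pro_comp_def pro_class_def using s_comp_cong[OF X Y Z] by (blast dest: transD)
  have "s \<in> pro_class X Y s" "t \<in> pro_class Y Z t"
    using equiv_class_self[OF equiv_s_equiv[OF X] s] equiv_class_self[OF equiv_s_equiv[OF Y] t]
    by (auto simp: pro_class_def)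
  then show "pro_class X Z (s_comp X Z t s) \<subseteq> pro_comp X Z (pro_class Y Z t) (pro_class X Y s)"
    unfolding pro_comp_def pro_class_def by blast
qed

lemma pro_class_in_hom: "s \<in> s_mor X Y \<Longrightarrow> pro_class X Y s \<in> pro_hom X Y"
  by (auto simp: pro_class_def pro_hom_def intro: quotientI)

section \<open>Projections\<close>

definition proj1_rep ::
    "('i, 'a) inv_system \<Rightarrow> ('j, 'b) inv_system \<Rightarrow> 'j \<Rightarrow> ('i \<times> 'j, 'a \<times> 'b, 'i, 'a) s_data" where
  "proj1_rep X Y m =
     (\<lambda>l. (l, m), \<lambda>n l. htop_class (prod_topology (sp X l) (sp Y m)) (sp X l) fst)"

definition proj2_rep ::
    "('i, 'a) inv_system \<Rightarrow> ('j, 'b) inv_system \<Rightarrow> 'i \<Rightarrow> ('i \<times> 'j, 'a \<times> 'b, 'j, 'b) s_data" where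
  "proj2_rep X Y l =
     (\<lambda>m. (l, m), \<lambda>n m. htop_class (prod_topology (sp X l) (sp Y m)) (sp Y m) snd)"

definition proj1 ::
    "('i, 'a) inv_system \<Rightarrow> ('j, 'b) inv_system \<Rightarrow> ('i \<times> 'j, 'a \<times> 'b, 'i, 'a) s_data set" where
  "proj1 X Y = pro_class (prod_system X Y) X (proj1_rep X Y (SOME m. m \<in> idx Y))"

definition proj2 ::
    "('i, 'a) inv_system \<Rightarrow> ('j, 'b) inv_system \<Rightarrow> ('i \<times> 'j, 'a \<times> 'b, 'j, 'b) s_data set" where
  "proj2 X Y = pro_class (prod_system X Y) Y (proj2_rep X Y (SOME l. l \<in> idx X))"

text \<open>The class of the representative does not depend on the index chosen by \<open>SOME\<close>.\<close>

lemma htop_class_fst_comp_prod: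
  assumes "F \<in> htop_hom X X'" "G \<in> htop_hom Y Y'"
  shows "htop_comp (prod_topology X Y) X' (htop_class (prod_topology X' Y') X' fst) (htop_prod X Y X' Y' F G)
    = htop_comp (prod_topology X Y) X' F (htop_class (prod_topology X Y) X fst)"
  using assms
  by (elim htop_homE)
    (simp add: htop_prod_class htop_comp_class continuous_map_map_prod continuous_map_fst fst_comp_map_prod)

lemma htop_class_snd_comp_prod:
  assumes "F \<in> htop_hom X X'" "G \<in> htop_hom Y Y'"
  shows "htop_comp (prod_topology X Y) Y' (htop_class (prod_topology X' Y') Y' snd) (htop_prod X Y X' Y' F G)
    = htop_comp (prod_topology X Y) Y' G (htop_class (prod_topology X Y) Y snd)"
  using assms
  by (elim htop_homE)
    (simp add: htop_prod_class htop_comp_class continuous_map_map_prod continuous_map_snd snd_comp_map_prod)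

lemma proj1_rep_in_s_mor:
  assumes X: "inverse_system X" and Y: "inverse_system Y" and m: "m \<in> idx Y"
  shows "proj1_rep X Y m \<in> s_mor (prod_system X Y) X"
proof -
  let ?pr = "\<lambda>l. htop_class (prod_topology (sp X l) (sp Y m)) (sp X l) fst"
  have "\<exists>p n. ((l, m), p) \<in> le (prod_system X Y) \<and> ((l', m), p) \<in> le (prod_system X Y) \<and>
     (\<forall>n'\<ge>n::nat. htop_comp (sp (prod_system X Y) p) (sp X l) (bond X l l')
          (htop_comp (sp (prod_system X Y) p) (sp X l') (?pr l') (bond (prod_system X Y) (l', m) p))
        = htop_comp (sp (prod_system X Y) p) (sp X l) (?pr l) (bond (prod_system X Y) (l, m) p))"
    if ll: "(l, l') \<in> le X" for l l'
  proof -
    have l: "l \<in> idx X" "l' \<in> idx X" using inverse_system_field[OF X ll] by auto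
    note b = inverse_system_bond[OF X ll] inverse_system_bond[OF X inverse_system_refl[OF X l(2)]]
      inverse_system_bond[OF Y inverse_system_refl[OF Y m]]
    have "htop_comp (prod_topology (sp X l') (sp Y m)) (sp X l') (bond X l' l') (?pr l') = ?pr l'"
      using l by (simp add: inverse_system_bond_id[OF X] htop_comp_id_left htop_class_in_hom continuous_map_fst)
    then have "htop_comp (sp (prod_system X Y) (l', m)) (sp X l) (bond X l l')
          (htop_comp (sp (prod_system X Y) (l', m)) (sp X l') (?pr l') (bond (prod_system X Y) (l', m) (l', m)))
        = htop_comp (sp (prod_system X Y) (l', m)) (sp X l) (?pr l) (bond (prod_system X Y) (l, m) (l', m))"
      using b by (simp add: prod_system_def htop_class_fst_comp_prod)
    moreover have "((l, m), (l', m)) \<in> le (prod_system X Y)" "((l', m), (l', m)) \<in> le (prod_system X Y)"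
      using ll l m by (auto simp: prod_system_def inverse_system_refl[OF X] inverse_system_refl[OF Y])
    ultimately show ?thesis by blast
  qed
  moreover have "\<forall>l\<in>idx X. ?pr l \<in> htop_hom (sp (prod_system X Y) (l, m)) (sp X l)"
    by (simp add: prod_system_def htop_class_in_hom continuous_map_fst)
  moreover have "(\<lambda>l. (l, m)) \<in> idx X \<rightarrow> idx (prod_system X Y)"
    using m by (simp add: prod_system_def)
  ultimately show ?thesis
    by (simp add: proj1_rep_def s_mor_def)
qed

lemma proj2_rep_in_s_mor:
  assumes X: "inverse_system X" and Y: "inverse_system Y" and l: "l \<in> idx X"
  shows "proj2_rep X Y l \<in> s_mor (prod_system X Y) Y"
proof -
  let ?pr = "\<lambda>m. htop_class (prod_topology (sp X l) (sp Y m)) (sp Y m) snd"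
  have "\<exists>p n. ((l, m), p) \<in> le (prod_system X Y) \<and> ((l, m'), p) \<in> le (prod_system X Y) \<and>
     (\<forall>n'\<ge>n::nat. htop_comp (sp (prod_system X Y) p) (sp Y m) (bond Y m m')
          (htop_comp (sp (prod_system X Y) p) (sp Y m') (?pr m') (bond (prod_system X Y) (l, m') p))
        = htop_comp (sp (prod_system X Y) p) (sp Y m) (?pr m) (bond (prod_system X Y) (l, m) p))"
    if mm: "(m, m') \<in> le Y" for m m'
  proof -
    have m: "m \<in> idx Y" "m' \<in> idx Y" using inverse_system_field[OF Y mm] by auto
    note b = inverse_system_bond[OF Y mm] inverse_system_bond[OF Y inverse_system_refl[OF Y m(2)]]
      inverse_system_bond[OF X inverse_system_refl[OF X l]]
    have "htop_comp (prod_topology (sp X l) (sp Y m')) (sp Y m') (bond Y m' m') (?pr m') = ?pr m'"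
      using m by (simp add: inverse_system_bond_id[OF Y] htop_comp_id_left htop_class_in_hom continuous_map_snd)
    then have "htop_comp (sp (prod_system X Y) (l, m')) (sp Y m) (bond Y m m')
          (htop_comp (sp (prod_system X Y) (l, m')) (sp Y m') (?pr m') (bond (prod_system X Y) (l, m') (l, m')))
        = htop_comp (sp (prod_system X Y) (l, m')) (sp Y m) (?pr m) (bond (prod_system X Y) (l, m) (l, m'))"
      using b by (simp add: prod_system_def htop_class_snd_comp_prod)
    moreover have "((l, m), (l, m')) \<in> le (prod_system X Y)" "((l, m'), (l, m')) \<in> le (prod_system X Y)"
      using mm l m by (auto simp: prod_system_def inverse_system_refl[OF X] inverse_system_refl[OF Y])
    ultimately show ?thesis by blast
  qed
  moreover have "\<forall>m\<in>idx Y. ?pr m \<in> htop_hom (sp (prod_system X Y) (l, m)) (sp Y m)"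
    by (simp add: prod_system_def htop_class_in_hom continuous_map_snd)
  moreover have "(\<lambda>m. (l, m)) \<in> idx Y \<rightarrow> idx (prod_system X Y)"
    using l by (simp add: prod_system_def)
  ultimately show ?thesis
    by (simp add: proj2_rep_def s_mor_def)
qed

lemma proj1_eq:
  assumes X: "inverse_system X" and Y: "inverse_system Y" and m: "m \<in> idx Y"
  shows "proj1 X Y = pro_class (prod_system X Y) X (proj1_rep X Y m)"
proof -
  define m0 where "m0 = (SOME m. m \<in> idx Y)"
  have m0: "m0 \<in> idx Y" unfolding m0_def using m by (rule someI)
  obtain v where v: "(m0, v) \<in> le Y" "(m, v) \<in> le Y" using inverse_system_upper[OF Y m0 m] by blast
  have eq: "\<exists>p n. ((l, m0), p) \<in> le (prod_system X Y) \<and> ((l, m), p) \<in> le (prod_system X Y) \<and>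
      (\<forall>n'\<ge>n::nat. htop_comp (sp (prod_system X Y) p) (sp X l)
        (htop_class (prod_topology (sp X l) (sp Y m0)) (sp X l) fst) (bond (prod_system X Y) (l, m0) p)
      = htop_comp (sp (prod_system X Y) p) (sp X l)
        (htop_class (prod_topology (sp X l) (sp Y m)) (sp X l) fst) (bond (prod_system X Y) (l, m) p))"
    if l: "l \<in> idx X" for l
  proof -
    have "htop_comp (sp (prod_system X Y) (l, v)) (sp X l)
        (htop_class (prod_topology (sp X l) (sp Y m0)) (sp X l) fst) (bond (prod_system X Y) (l, m0) (l, v))
      = htop_comp (sp (prod_system X Y) (l, v)) (sp X l)
        (htop_class (prod_topology (sp X l) (sp Y m)) (sp X l) fst) (bond (prod_system X Y) (l, m) (l, v))"
      using inverse_system_bond[OF X inverse_system_refl[OF X l]] v[THEN inverse_system_bond[OF Y]]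
      by (simp add: prod_system_def htop_class_fst_comp_prod)
    moreover have "((l, m0), (l, v)) \<in> le (prod_system X Y)" "((l, m), (l, v)) \<in> le (prod_system X Y)"
      using v l by (auto simp: prod_system_def inverse_system_refl[OF X])
    ultimately show ?thesis by blast
  qed
  have "(proj1_rep X Y m0, proj1_rep X Y m) \<in> s_equiv (prod_system X Y) X"
    using proj1_rep_in_s_mor[OF X Y m0] proj1_rep_in_s_mor[OF X Y m] eq
    by (simp add: s_equiv_def proj1_rep_def)
  then show ?thesis
    unfolding proj1_def m0_def[symmetric] pro_class_def
    by (rule equiv_class_eq[OF equiv_s_equiv[OF inverse_system_prod_system[OF X Y]]])
qed

lemma proj2_eq:
  assumes X: "inverse_system X" and Y: "inverse_system Y" and l: "l \<in> idx X"
  shows "proj2 X Y = pro_class (prod_system X Y) Y (proj2_rep X Y l)"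
proof -
  define l0 where "l0 = (SOME l. l \<in> idx X)"
  have l0: "l0 \<in> idx X" unfolding l0_def using l by (rule someI)
  obtain v where v: "(l0, v) \<in> le X" "(l, v) \<in> le X" using inverse_system_upper[OF X l0 l] by blast
  have eq: "\<exists>p n. ((l0, m), p) \<in> le (prod_system X Y) \<and> ((l, m), p) \<in> le (prod_system X Y) \<and>
      (\<forall>n'\<ge>n::nat. htop_comp (sp (prod_system X Y) p) (sp Y m)
        (htop_class (prod_topology (sp X l0) (sp Y m)) (sp Y m) snd) (bond (prod_system X Y) (l0, m) p)
      = htop_comp (sp (prod_system X Y) p) (sp Y m)
        (htop_class (prod_topology (sp X l) (sp Y m)) (sp Y m) snd) (bond (prod_system X Y) (l, m) p))"
    if m: "m \<in> idx Y" for m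
  proof -
    have "htop_comp (sp (prod_system X Y) (v, m)) (sp Y m)
        (htop_class (prod_topology (sp X l0) (sp Y m)) (sp Y m) snd) (bond (prod_system X Y) (l0, m) (v, m))
      = htop_comp (sp (prod_system X Y) (v, m)) (sp Y m)
        (htop_class (prod_topology (sp X l) (sp Y m)) (sp Y m) snd) (bond (prod_system X Y) (l, m) (v, m))"
      using inverse_system_bond[OF Y inverse_system_refl[OF Y m]] v[THEN inverse_system_bond[OF X]]
      by (simp add: prod_system_def htop_class_snd_comp_prod)
    moreover have "((l0, m), (v, m)) \<in> le (prod_system X Y)" "((l, m), (v, m)) \<in> le (prod_system X Y)"
      using v m by (auto simp: prod_system_def inverse_system_refl[OF Y])
    ultimately show ?thesis by blast
  qed
  have "(proj2_rep X Y l0, proj2_rep X Y l) \<in> s_equiv (prod_system X Y) Y"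
    using proj2_rep_in_s_mor[OF X Y l0] proj2_rep_in_s_mor[OF X Y l] eq
    by (simp add: s_equiv_def proj2_rep_def)
  then show ?thesis
    unfolding proj2_def l0_def[symmetric] pro_class_def
    by (rule equiv_class_eq[OF equiv_s_equiv[OF inverse_system_prod_system[OF X Y]]])
qed

end

theory Submission
  imports Defs
begin

text \<open>
  The projections of \<open>X \<times> Y\<close> exhibit \<open>prod_topology X Y\<close> as a categorical product in HTop:
  maps into both factors pair to a map into the product, and two homotopies pair to a homotopy
  (\<open>htop_pair_exists\<close>, \<open>htop_prod_ext\<close>). The theorem lifts this universal property from single
  spaces to inverse systems.

  For existence, let \<open>s : Z \<rightarrow> X\<close> and \<open>t : Z \<rightarrow> Y\<close> represent the given morphisms. Their components
  at \<open>l\<close> and \<open>m\<close> start from different terms of \<open>Z\<close>, so directedness of the index set of \<open>Z\<close> is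
  used to choose a common later stage \<open>w (l, m)\<close>; there both can be restricted and, for every \<open>n\<close>,
  paired to a class into \<open>X\<^sub>l \<times> Y\<^sub>m\<close>. The coherence condition for the paired data is an
  equation between classes into a product, so it may be checked after each projection, where it
  becomes the coherence of \<open>s\<close> or of \<open>t\<close> (\<open>pro_pair_exists\<close>).

  For uniqueness, let two morphisms into the product system have the same two composites. The
  projections may be represented with any fixed second index; to compare the components
  at \<open>(l, m)\<close> one takes the first projection with index \<open>m\<close> and the second with index \<open>l\<close>, so that
  both composites involve precisely the component at \<open>(l, m)\<close>. From some stage on, both
  projections of the two components agree, hence the components agree (\<open>pro_prod_ext\<close>).

  All conditions on \<open>S\<^sup>*\<close>-morphisms have the form "at some stage of the source and from
  some \<open>n\<close> on". They persist to later stages, so they can be read as holding at all sufficiently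
  late pairs of a stage and a number \<open>n\<close>, and two such conditions can be imposed together.
\<close>

section \<open>Products in the homotopy category\<close>

abbreviation htop_fst :: "'a topology \<Rightarrow> 'b topology \<Rightarrow> ('a \<times> 'b \<Rightarrow> 'a) set" where
  "htop_fst A B \<equiv> htop_class (prod_topology A B) A fst"

abbreviation htop_snd :: "'a topology \<Rightarrow> 'b topology \<Rightarrow> ('a \<times> 'b \<Rightarrow> 'b) set" where
  "htop_snd A B \<equiv> htop_class (prod_topology A B) B snd"

lemma htop_fst_in_hom: "htop_fst A B \<in> htop_hom (prod_topology A B) A"
  by (simp add: htop_class_in_hom continuous_map_fst)

lemma htop_snd_in_hom: "htop_snd A B \<in> htop_hom (prod_topology A B) B"
  by (simp add: htop_class_in_hom continuous_map_snd)

lemma htop_pair_exists: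
  assumes "F \<in> htop_hom W A" "G \<in> htop_hom W B"
  shows "\<exists>H \<in> htop_hom W (prod_topology A B).
    htop_comp W A (htop_fst A B) H = F \<and> htop_comp W B (htop_snd A B) H = G"
proof -
  obtain f g where f: "continuous_map W A f" "F = htop_class W A f"
    and g: "continuous_map W B g" "G = htop_class W B g"
    using assms by (meson htop_homE)
  have fg: "continuous_map W (prod_topology A B) (\<lambda>x. (f x, g x))"
    using f g by (simp add: continuous_map_pairwise o_def)
  have "fst \<circ> (\<lambda>x. (f x, g x)) = f" "snd \<circ> (\<lambda>x. (f x, g x)) = g"
    by auto
  then show ?thesis
    using f g fg htop_class_in_hom[OF fg]
    by (intro bexI[of _ "htop_class W (prod_topology A B) (\<lambda>x. (f x, g x))"])
      (simp_all add: htop_comp_class[OF fg] continuous_map_fst continuous_map_snd)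
qed

text \<open>Homotopies of the two components, run simultaneously, form a homotopy of the maps into
  the product; so the projections stay jointly monic after passing to homotopy classes.\<close>

lemma htop_prod_ext:
  assumes "H \<in> htop_hom W (prod_topology A B)" "K \<in> htop_hom W (prod_topology A B)"
    and "htop_comp W A (htop_fst A B) H = htop_comp W A (htop_fst A B) K"
    and "htop_comp W B (htop_snd A B) H = htop_comp W B (htop_snd A B) K"
  shows "H = K"
proof -
  obtain h k where h: "continuous_map W (prod_topology A B) h" "H = htop_class W (prod_topology A B) h"
    and k: "continuous_map W (prod_topology A B) k" "K = htop_class W (prod_topology A B) k"
    using assms(1,2) by (meson htop_homE)
  have c: "continuous_map W A (fst \<circ> h)" "continuous_map W A (fst \<circ> k)"
    "continuous_map W B (snd \<circ> h)" "continuous_map W B (snd \<circ> k)"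
    using h k by (simp_all add: continuous_map_pairwise)
  have "homotopic_with (\<lambda>_. True) W A (fst \<circ> h) (fst \<circ> k)"
    "homotopic_with (\<lambda>_. True) W B (snd \<circ> h) (snd \<circ> k)"
    using assms(3,4) h k c
    by (simp_all add: htop_comp_class continuous_map_fst continuous_map_snd htop_class_eq_iff)
  then obtain p q where
    p: "continuous_map (prod_topology (top_of_set {0..1::real}) W) A p"
      "\<forall>x. p (0, x) = (fst \<circ> h) x" "\<forall>x. p (1, x) = (fst \<circ> k) x" and
    q: "continuous_map (prod_topology (top_of_set {0..1::real}) W) B q"
      "\<forall>x. q (0, x) = (snd \<circ> h) x" "\<forall>x. q (1, x) = (snd \<circ> k) x"
    unfolding homotopic_with_def by blast
  have "homotopic_with (\<lambda>_. True) W (prod_topology A B) h k"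
    unfolding homotopic_with_def
    using p q by (intro exI[of _ "\<lambda>z. (p z, q z)"]) (simp add: continuous_map_pairwise o_def)
  with h k show ?thesis
    by (simp add: htop_class_eq_iff)
qed

section \<open>Properties that hold at all late stages\<close>

definition late :: "('i, 'a) inv_system \<Rightarrow> ('i \<Rightarrow> nat \<Rightarrow> bool) \<Rightarrow> bool" where
  "late X P \<longleftrightarrow> (\<exists>l\<in>idx X. \<exists>n. \<forall>l' n'. (l, l') \<in> le X \<longrightarrow> n \<le> n' \<longrightarrow> P l' n')"

lemma late_conj:
  assumes X: "inverse_system X" and P: "late X P" and Q: "late X Q"
  shows "late X (\<lambda>l n. P l n \<and> Q l n)"
proof -
  obtain a i where a: "a \<in> idx X" "\<And>l n. (a, l) \<in> le X \<Longrightarrow> i \<le> n \<Longrightarrow> P l n"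
    using P by (auto simp: late_def)
  obtain b j where b: "b \<in> idx X" "\<And>l n. (b, l) \<in> le X \<Longrightarrow> j \<le> n \<Longrightarrow> Q l n"
    using Q by (auto simp: late_def)
  obtain c where c: "(a, c) \<in> le X" "(b, c) \<in> le X"
    using inverse_system_upper[OF X a(1) b(1)] by blast
  have "P l n \<and> Q l n" if "(c, l) \<in> le X" "max i j \<le> n" for l n
    using a(2)[of l n] b(2)[of l n] inverse_system_trans[OF X c(1)] inverse_system_trans[OF X c(2)] that
    by auto
  then show ?thesis
    unfolding late_def using inverse_system_field[OF X c(1)] by blast
qed

lemma late_mono: "late X P \<Longrightarrow> (\<And>l n. P l n \<Longrightarrow> Q l n) \<Longrightarrow> late X Q"
  unfolding late_def by meson

lemma late_above: "inverse_system X \<Longrightarrow> i \<in> idx X \<Longrightarrow> late X (\<lambda>l n. (i, l) \<in> le X)"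
  unfolding late_def by blast

text \<open>Links the form of the conditions in \<open>s_mor\<close> and \<open>s_equiv\<close>, which ask for a single stage above
  two given indices, with \<open>late\<close>, for which conjunctions are available. Equations between
  restricted components meet the hypothesis \<open>up\<close>: one composes both sides with a further bonding
  morphism.\<close>

lemma ex_stage_iff_late:
  assumes X: "inverse_system X" and "i \<in> idx X" "j \<in> idx X"
    and up: "\<And>l l' n. \<lbrakk>(i, l) \<in> le X; (j, l) \<in> le X; (l, l') \<in> le X; P l n\<rbrakk> \<Longrightarrow> P l' n"
  shows "(\<exists>l n. (i, l) \<in> le X \<and> (j, l) \<in> le X \<and> (\<forall>n'\<ge>n. P l n')) \<longleftrightarrow> late X P"
proof
  assume "\<exists>l n. (i, l) \<in> le X \<and> (j, l) \<in> le X \<and> (\<forall>n'\<ge>n. P l n')"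
  then obtain l n where l: "(i, l) \<in> le X" "(j, l) \<in> le X" "\<forall>n'\<ge>n. P l n'"
    by blast
  then show "late X P"
    unfolding late_def using up inverse_system_field[OF X l(1)] by blast
next
  assume "late X P"
  then have "late X (\<lambda>l n. ((i, l) \<in> le X \<and> (j, l) \<in> le X) \<and> P l n)"
    using assms by (intro late_conj late_above)
  then obtain l n where l: "l \<in> idx X" and
    e: "\<And>n'. n \<le> n' \<Longrightarrow> ((i, l) \<in> le X \<and> (j, l) \<in> le X) \<and> P l n'"
    unfolding late_def using inverse_system_refl[OF X] by blast
  show "\<exists>l n. (i, l) \<in> le X \<and> (j, l) \<in> le X \<and> (\<forall>n'\<ge>n. P l n')"
    using e by blast
qed

text \<open>The component \<open>F n m : X\<^bsub>f m\<^esub> \<rightarrow> Y\<^sub>m\<close> of \<open>s = (f, F)\<close>, restricted to the stage \<open>l\<close> along the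
  bonding morphism. Restricted components at a common stage have the same source and so can be
  compared.\<close>

definition level ::
    "('i, 'a) inv_system \<Rightarrow> ('j, 'b) inv_system \<Rightarrow>
     ('i, 'a, 'j, 'b) s_data \<Rightarrow> 'i \<Rightarrow> nat \<Rightarrow> 'j \<Rightarrow> ('a \<Rightarrow> 'b) set" where
  "level X Y s l n m = htop_comp (sp X l) (sp Y m) (snd s n m) (bond X (fst s m) l)"

lemma level_in_hom:
  assumes "inverse_system X" "(fst s m, l) \<in> le X" "snd s n m \<in> htop_hom (sp X (fst s m)) (sp Y m)"
  shows "level X Y s l n m \<in> htop_hom (sp X l) (sp Y m)"
  unfolding level_def by (rule htop_comp_in_hom[OF inverse_system_bond[OF assms(1,2)] assms(3)])

lemma level_later:
  assumes "inverse_system X" "(fst s m, l) \<in> le X" "(l, l') \<in> le X"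
    "snd s n m \<in> htop_hom (sp X (fst s m)) (sp Y m)"
  shows "level X Y s l' n m = htop_comp (sp X l') (sp Y m) (level X Y s l n m) (bond X l l')"
  unfolding level_def using assms by (rule s_level_comp)

lemma s_mor_iff:
  assumes X: "inverse_system X" and Y: "inverse_system Y"
  shows "s \<in> s_mor X Y \<longleftrightarrow>
    (\<forall>m\<in>idx Y. fst s m \<in> idx X) \<and>
    (\<forall>n. \<forall>m\<in>idx Y. snd s n m \<in> htop_hom (sp X (fst s m)) (sp Y m)) \<and>
    (\<forall>m m'. (m, m') \<in> le Y \<longrightarrow> late X (\<lambda>l n.
       htop_comp (sp X l) (sp Y m) (bond Y m m') (level X Y s l n m') = level X Y s l n m))"
    (is "_ \<longleftrightarrow> ?I \<and> ?H \<and> ?C")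
proof -
  let ?S = "\<forall>m m'. (m, m') \<in> le Y \<longrightarrow> (\<exists>l n. (fst s m, l) \<in> le X \<and> (fst s m', l) \<in> le X \<and>
    (\<forall>n'\<ge>n. htop_comp (sp X l) (sp Y m) (bond Y m m') (level X Y s l n' m') = level X Y s l n' m))"
  have "s \<in> s_mor X Y \<longleftrightarrow> ?I \<and> ?H \<and> ?S"
    by (cases s) (auto simp: s_mor_def level_def Pi_iff)
  moreover have "?S \<longleftrightarrow> ?C" if I: ?I and H: ?H
  proof (intro all_cong1 imp_cong refl ex_stage_iff_late[OF X])
    fix m m' assume mm: "(m, m') \<in> le Y"
    then have m: "m \<in> idx Y" "m' \<in> idx Y"
      using inverse_system_field[OF Y mm] by auto
    then show "fst s m \<in> idx X" "fst s m' \<in> idx X"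
      using I by auto
    fix l l' n
    assume l: "(fst s m, l) \<in> le X" "(fst s m', l) \<in> le X" and ll': "(l, l') \<in> le X"
      and e: "htop_comp (sp X l) (sp Y m) (bond Y m m') (level X Y s l n m') = level X Y s l n m"
    have h: "snd s n m \<in> htop_hom (sp X (fst s m)) (sp Y m)"
      "snd s n m' \<in> htop_hom (sp X (fst s m')) (sp Y m')"
      using H m by auto
    show "htop_comp (sp X l') (sp Y m) (bond Y m m') (level X Y s l' n m') = level X Y s l' n m"
      unfolding level_later[OF X l(1) ll' h(1)] level_later[OF X l(2) ll' h(2)] e[symmetric]
      using inverse_system_bond[OF X ll'] level_in_hom[OF X l(2) h(2)] inverse_system_bond[OF Y mm]
      by (rule htop_comp_assoc[symmetric])
  qed
  ultimately show ?thesis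
    by blast
qed

lemma s_equiv_iff:
  assumes X: "inverse_system X" and Y: "inverse_system Y"
    and s: "s \<in> s_mor X Y" and t: "t \<in> s_mor X Y"
  shows "(s, t) \<in> s_equiv X Y \<longleftrightarrow>
    (\<forall>m\<in>idx Y. late X (\<lambda>l n. level X Y s l n m = level X Y t l n m))" (is "_ \<longleftrightarrow> ?C")
proof -
  have "(s, t) \<in> s_equiv X Y \<longleftrightarrow> (\<forall>m\<in>idx Y. \<exists>l n. (fst s m, l) \<in> le X \<and> (fst t m, l) \<in> le X \<and>
    (\<forall>n'\<ge>n. level X Y s l n' m = level X Y t l n' m))"
    using s t by (cases s; cases t) (auto simp: s_equiv_def level_def)
  also have "\<dots> \<longleftrightarrow> ?C"
  proof (intro ball_cong refl ex_stage_iff_late[OF X])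
    fix m assume m: "m \<in> idx Y"
    then show "fst s m \<in> idx X" "fst t m \<in> idx X"
      using s t by (auto simp: s_mor_iff[OF X Y])
    fix l l' n assume "(fst s m, l) \<in> le X" "(fst t m, l) \<in> le X" "(l, l') \<in> le X"
      "level X Y s l n m = level X Y t l n m"
    then show "level X Y s l' n m = level X Y t l' n m"
      using s t m by (simp add: level_later[OF X] s_mor_iff[OF X Y])
  qed
  finally show ?thesis .
qed

lemma pro_class_eq_iff:
  assumes "inverse_system X" "s \<in> s_mor X Y" "t \<in> s_mor X Y"
  shows "pro_class X Y s = pro_class X Y t \<longleftrightarrow> (s, t) \<in> s_equiv X Y"
  unfolding pro_class_def using eq_equiv_class_iff[OF equiv_s_equiv[OF assms(1)]] assms by blast

lemma pro_homE:
  assumes "f \<in> pro_hom X Y"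
  obtains s where "s \<in> s_mor X Y" "f = pro_class X Y s"
  using assms by (auto simp: pro_hom_def pro_class_def elim!: quotientE)

section \<open>Levels of a morphism into a product system\<close>

lemma prod_system_simps [simp]:
  "idx (prod_system X Y) = idx X \<times> idx Y"
  "((i, j), (i', j')) \<in> le (prod_system X Y) \<longleftrightarrow> (i, i') \<in> le X \<and> (j, j') \<in> le Y"
  "sp (prod_system X Y) (i, j) = prod_topology (sp X i) (sp Y j)"
  "bond (prod_system X Y) (i, j) (i', j') =
     htop_prod (sp X i') (sp Y j') (sp X i) (sp Y j) (bond X i i') (bond Y j j')"
  by (simp_all add: prod_system_def)

text \<open>Projecting the restricted component at \<open>(l, m)\<close> gives the restricted component at \<open>l\<close> of the
  composite with the projection, because the second index of the representative is taken to
  be \<open>m\<close>.\<close>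

lemma level_proj1:
  assumes Z: "inverse_system Z" and "(fst s (l, m), k) \<in> le Z"
    and "snd s n (l, m) \<in> htop_hom (sp Z (fst s (l, m))) (prod_topology (sp X l) (sp Y m))"
  shows "level Z X (s_comp Z X (proj1_rep X Y m) s) k n l =
    htop_comp (sp Z k) (sp X l) (htop_fst (sp X l) (sp Y m)) (level Z (prod_system X Y) s k n (l, m))"
  using htop_comp_assoc[OF inverse_system_bond[OF Z assms(2)] assms(3) htop_fst_in_hom]
  by (simp add: level_def s_comp_def proj1_rep_def split_def)

lemma level_proj2:
  assumes Z: "inverse_system Z" and "(fst s (l, m), k) \<in> le Z"
    and "snd s n (l, m) \<in> htop_hom (sp Z (fst s (l, m))) (prod_topology (sp X l) (sp Y m))"
  shows "level Z Y (s_comp Z Y (proj2_rep X Y l) s) k n m =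
    htop_comp (sp Z k) (sp Y m) (htop_snd (sp X l) (sp Y m)) (level Z (prod_system X Y) s k n (l, m))"
  using htop_comp_assoc[OF inverse_system_bond[OF Z assms(2)] assms(3) htop_snd_in_hom]
  by (simp add: level_def s_comp_def proj2_rep_def split_def)

text \<open>Since the class of \<open>proj1_rep X Y m\<close> does not depend on \<open>m\<close>, the composite with the
  projection can be computed with whichever index suits the component under consideration.\<close>

lemma pro_comp_proj1:
  assumes X: "inverse_system X" and Y: "inverse_system Y" and Z: "inverse_system Z"
    and s: "s \<in> s_mor Z (prod_system X Y)" and m: "m \<in> idx Y"
  shows "pro_comp Z X (proj1 X Y) (pro_class Z (prod_system X Y) s)
    = pro_class Z X (s_comp Z X (proj1_rep X Y m) s)"
  unfolding proj1_eq[OF X Y m]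
  by (rule pro_comp_class[OF Z inverse_system_prod_system[OF X Y] X s proj1_rep_in_s_mor[OF X Y m]])

lemma pro_comp_proj2:
  assumes X: "inverse_system X" and Y: "inverse_system Y" and Z: "inverse_system Z"
    and s: "s \<in> s_mor Z (prod_system X Y)" and l: "l \<in> idx X"
  shows "pro_comp Z Y (proj2 X Y) (pro_class Z (prod_system X Y) s)
    = pro_class Z Y (s_comp Z Y (proj2_rep X Y l) s)"
  unfolding proj2_eq[OF X Y l]
  by (rule pro_comp_class[OF Z inverse_system_prod_system[OF X Y] Y s proj2_rep_in_s_mor[OF X Y l]])

lemma s_comp_proj1_in_s_mor:
  assumes X: "inverse_system X" and Y: "inverse_system Y" and Z: "inverse_system Z"
    and s: "s \<in> s_mor Z (prod_system X Y)" and m: "m \<in> idx Y"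
  shows "s_comp Z X (proj1_rep X Y m) s \<in> s_mor Z X"
  by (rule s_comp_in_s_mor[OF Z inverse_system_prod_system[OF X Y] X s proj1_rep_in_s_mor[OF X Y m]])

lemma s_comp_proj2_in_s_mor:
  assumes X: "inverse_system X" and Y: "inverse_system Y" and Z: "inverse_system Z"
    and s: "s \<in> s_mor Z (prod_system X Y)" and l: "l \<in> idx X"
  shows "s_comp Z Y (proj2_rep X Y l) s \<in> s_mor Z Y"
  by (rule s_comp_in_s_mor[OF Z inverse_system_prod_system[OF X Y] Y s proj2_rep_in_s_mor[OF X Y l]])

section \<open>The universal property\<close>

text \<open>The components at \<open>(l, m)\<close> are compared separately for each pair: the stages from which
  they agree may vary with \<open>(l, m)\<close>, as equivalence of \<open>S\<^sup>*\<close>-morphisms allows. At each pair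
  joint monicity of the projections in HTop suffices.\<close>

lemma pro_prod_ext:
  assumes X: "inverse_system X" and Y: "inverse_system Y" and Z: "inverse_system Z"
    and h: "h \<in> pro_hom Z (prod_system X Y)" and h': "h' \<in> pro_hom Z (prod_system X Y)"
    and e1: "pro_comp Z X (proj1 X Y) h = pro_comp Z X (proj1 X Y) h'"
    and e2: "pro_comp Z Y (proj2 X Y) h = pro_comp Z Y (proj2 X Y) h'"
  shows "h = h'"
proof -
  note XY = inverse_system_prod_system[OF X Y]
  obtain s t where s: "s \<in> s_mor Z (prod_system X Y)" "h = pro_class Z (prod_system X Y) s"
    and t: "t \<in> s_mor Z (prod_system X Y)" "h' = pro_class Z (prod_system X Y) t"
    using h h' by (metis pro_homE)
  have "late Z (\<lambda>k n. level Z (prod_system X Y) s k n (l, m) = level Z (prod_system X Y) t k n (l, m))"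
    if l: "l \<in> idx X" and m: "m \<in> idx Y" for l m
  proof -
    have i: "fst s (l, m) \<in> idx Z" "fst t (l, m) \<in> idx Z"
      and hom: "snd s n (l, m) \<in> htop_hom (sp Z (fst s (l, m))) (prod_topology (sp X l) (sp Y m))"
        "snd t n (l, m) \<in> htop_hom (sp Z (fst t (l, m))) (prod_topology (sp X l) (sp Y m))" for n
      using s(1) t(1) l m by (auto simp: s_mor_iff[OF Z XY])
    have "(s_comp Z X (proj1_rep X Y m) s, s_comp Z X (proj1_rep X Y m) t) \<in> s_equiv Z X"
      using e1 s t m X Y Z
      by (simp add: pro_comp_proj1 s_comp_proj1_in_s_mor pro_class_eq_iff[symmetric])
    then have l1: "late Z (\<lambda>k n. level Z X (s_comp Z X (proj1_rep X Y m) s) k n l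
        = level Z X (s_comp Z X (proj1_rep X Y m) t) k n l)"
      using s t l m X Y Z by (simp add: s_equiv_iff s_comp_proj1_in_s_mor)
    have "(s_comp Z Y (proj2_rep X Y l) s, s_comp Z Y (proj2_rep X Y l) t) \<in> s_equiv Z Y"
      using e2 s t l X Y Z
      by (simp add: pro_comp_proj2 s_comp_proj2_in_s_mor pro_class_eq_iff[symmetric])
    then have l2: "late Z (\<lambda>k n. level Z Y (s_comp Z Y (proj2_rep X Y l) s) k n m
        = level Z Y (s_comp Z Y (proj2_rep X Y l) t) k n m)"
      using s t l m X Y Z by (simp add: s_equiv_iff s_comp_proj2_in_s_mor)
    note late_conj[OF Z late_conj[OF Z late_above[OF Z i(1)] late_above[OF Z i(2)]] late_conj[OF Z l1 l2]]
    then show ?thesis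
    proof (rule late_mono, elim conjE)
      fix k n
      assume k: "(fst s (l, m), k) \<in> le Z" "(fst t (l, m), k) \<in> le Z"
        and e: "level Z X (s_comp Z X (proj1_rep X Y m) s) k n l
          = level Z X (s_comp Z X (proj1_rep X Y m) t) k n l"
          "level Z Y (s_comp Z Y (proj2_rep X Y l) s) k n m
          = level Z Y (s_comp Z Y (proj2_rep X Y l) t) k n m"
      have "level Z (prod_system X Y) s k n (l, m) \<in> htop_hom (sp Z k) (prod_topology (sp X l) (sp Y m))"
        "level Z (prod_system X Y) t k n (l, m) \<in> htop_hom (sp Z k) (prod_topology (sp X l) (sp Y m))"
        using level_in_hom[OF Z k(1), of n "prod_system X Y"] level_in_hom[OF Z k(2), of n "prod_system X Y"] hom
        by auto
      then show "level Z (prod_system X Y) s k n (l, m) = level Z (prod_system X Y) t k n (l, m)"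
        by (rule htop_prod_ext)
          (use e in \<open>simp_all add: level_proj1[OF Z k(1) hom(1)] level_proj1[OF Z k(2) hom(2)]
            level_proj2[OF Z k(1) hom(1)] level_proj2[OF Z k(2) hom(2)]\<close>)
    qed
  qed
  then have "(s, t) \<in> s_equiv Z (prod_system X Y)"
    using s t by (simp add: s_equiv_iff[OF Z XY])
  with s t show ?thesis
    by (simp add: pro_class_eq_iff[OF Z])
qed

text \<open>The pairing is formed from representatives, at a common stage \<open>w (l, m)\<close> of \<open>Z\<close> above the
  indices that \<open>s\<close> assigns to \<open>l\<close> and \<open>t\<close> assigns to \<open>m\<close>. As no compatibility is imposed on the
  choices of \<open>w\<close>, coherence is established only far above them, where both sides
  are determined by their projections.\<close>

lemma pro_pair_exists:
  assumes X: "inverse_system X" and Y: "inverse_system Y" and Z: "inverse_system Z"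
    and f: "f \<in> pro_hom Z X" and g: "g \<in> pro_hom Z Y"
  shows "\<exists>h \<in> pro_hom Z (prod_system X Y).
    pro_comp Z X (proj1 X Y) h = f \<and> pro_comp Z Y (proj2 X Y) h = g"
proof -
  note XY = inverse_system_prod_system[OF X Y]
  obtain s t where s: "s \<in> s_mor Z X" "f = pro_class Z X s" and t: "t \<in> s_mor Z Y" "g = pro_class Z Y t"
    using f g by (metis pro_homE)
  have hs: "fst s l \<in> idx Z" "snd s n l \<in> htop_hom (sp Z (fst s l)) (sp X l)" if "l \<in> idx X" for n l
    using s(1) that by (auto simp: s_mor_iff[OF Z X])
  have ht: "fst t m \<in> idx Z" "snd t n m \<in> htop_hom (sp Z (fst t m)) (sp Y m)" if "m \<in> idx Y" for n m
    using t(1) that by (auto simp: s_mor_iff[OF Z Y])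
  have "\<exists>k. (fst s l, k) \<in> le Z \<and> (fst t m, k) \<in> le Z" if "l \<in> idx X" "m \<in> idx Y" for l m
    using inverse_system_upper[OF Z] hs(1) ht(1) that by blast
  then obtain w' where "\<And>l m. l \<in> idx X \<Longrightarrow> m \<in> idx Y \<Longrightarrow>
      (fst s l, w' l m) \<in> le Z \<and> (fst t m, w' l m) \<in> le Z"
    by metis
  then obtain w where w: "(fst s l, w (l, m)) \<in> le Z" "(fst t m, w (l, m)) \<in> le Z"
    if "l \<in> idx X" "m \<in> idx Y" for l m
    using that[of "case_prod w'"] by simp
  have "\<exists>H \<in> htop_hom (sp Z (w (l, m))) (prod_topology (sp X l) (sp Y m)).
      htop_comp (sp Z (w (l, m))) (sp X l) (htop_fst (sp X l) (sp Y m)) H = level Z X s (w (l, m)) n l \<and>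
      htop_comp (sp Z (w (l, m))) (sp Y m) (htop_snd (sp X l) (sp Y m)) H = level Z Y t (w (l, m)) n m"
    if "l \<in> idx X" "m \<in> idx Y" for l m n
    using that by (intro htop_pair_exists level_in_hom[OF Z] w hs ht)
  then obtain H' where "\<And>l m n. l \<in> idx X \<Longrightarrow> m \<in> idx Y \<Longrightarrow>
      H' l m n \<in> htop_hom (sp Z (w (l, m))) (prod_topology (sp X l) (sp Y m)) \<and>
      htop_comp (sp Z (w (l, m))) (sp X l) (htop_fst (sp X l) (sp Y m)) (H' l m n) = level Z X s (w (l, m)) n l \<and>
      htop_comp (sp Z (w (l, m))) (sp Y m) (htop_snd (sp X l) (sp Y m)) (H' l m n) = level Z Y t (w (l, m)) n m"
    by metis
  then obtain H where H: "H n (l, m) \<in> htop_hom (sp Z (w (l, m))) (prod_topology (sp X l) (sp Y m))"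
      "htop_comp (sp Z (w (l, m))) (sp X l) (htop_fst (sp X l) (sp Y m)) (H n (l, m)) = level Z X s (w (l, m)) n l"
      "htop_comp (sp Z (w (l, m))) (sp Y m) (htop_snd (sp X l) (sp Y m)) (H n (l, m)) = level Z Y t (w (l, m)) n m"
    if "l \<in> idx X" "m \<in> idx Y" for l m n
    using that[of "\<lambda>n (l, m). H' l m n"] by simp
  define u where "u = (w, H)"
  let ?lev = "level Z (prod_system X Y) u"
  have lev_hom: "?lev k n (l, m) \<in> htop_hom (sp Z k) (prod_topology (sp X l) (sp Y m))"
    if "l \<in> idx X" "m \<in> idx Y" "(w (l, m), k) \<in> le Z" for l m n k
    using level_in_hom[OF Z, of u "(l, m)" k n "prod_system X Y"] H(1)[OF that(1,2)] that(3)
    by (simp add: u_def)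
  have lev1: "htop_comp (sp Z k) (sp X l) (htop_fst (sp X l) (sp Y m)) (?lev k n (l, m)) = level Z X s k n l"
    if lm: "l \<in> idx X" "m \<in> idx Y" and k: "(w (l, m), k) \<in> le Z" for l m n k
    using htop_comp_assoc[OF inverse_system_bond[OF Z k] H(1)[OF lm] htop_fst_in_hom]
      level_later[OF Z w(1)[OF lm] k hs(2)[OF lm(1)]] H(2)[OF lm]
    by (simp add: level_def[of Z "prod_system X Y"] u_def)
  have lev2: "htop_comp (sp Z k) (sp Y m) (htop_snd (sp X l) (sp Y m)) (?lev k n (l, m)) = level Z Y t k n m"
    if lm: "l \<in> idx X" "m \<in> idx Y" and k: "(w (l, m), k) \<in> le Z" for l m n k
    using htop_comp_assoc[OF inverse_system_bond[OF Z k] H(1)[OF lm] htop_snd_in_hom]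
      level_later[OF Z w(2)[OF lm] k ht(2)[OF lm(2)]] H(3)[OF lm]
    by (simp add: level_def[of Z "prod_system X Y"] u_def)
  have wZ: "w (l, m) \<in> idx Z" if "l \<in> idx X" "m \<in> idx Y" for l m
    using inverse_system_field[OF Z w(1)[OF that]] by simp
  have coherent: "late Z (\<lambda>k n. htop_comp (sp Z k) (prod_topology (sp X l) (sp Y m))
      (htop_prod (sp X l') (sp Y m') (sp X l) (sp Y m) (bond X l l') (bond Y m m')) (?lev k n (l', m'))
      = ?lev k n (l, m))"
    if ll: "(l, l') \<in> le X" and mm: "(m, m') \<in> le Y" for l l' m m'
  proof -
    have lm: "l \<in> idx X" "m \<in> idx Y" "l' \<in> idx X" "m' \<in> idx Y"
      using inverse_system_field[OF X ll] inverse_system_field[OF Y mm] by auto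
    note bX = inverse_system_bond[OF X ll] and bY = inverse_system_bond[OF Y mm]
    have l1: "late Z (\<lambda>k n. htop_comp (sp Z k) (sp X l) (bond X l l') (level Z X s k n l') = level Z X s k n l)"
      using s(1) ll by (simp add: s_mor_iff[OF Z X])
    have l2: "late Z (\<lambda>k n. htop_comp (sp Z k) (sp Y m) (bond Y m m') (level Z Y t k n m') = level Z Y t k n m)"
      using t(1) mm by (simp add: s_mor_iff[OF Z Y])
    \<comment> \<open>At a stage above both chosen indices at which \<open>s\<close> and \<open>t\<close> are already coherent, the two sides
      have the same projections.\<close>
    note late_conj[OF Z late_conj[OF Z late_above[OF Z wZ[OF lm(1,2)]] late_above[OF Z wZ[OF lm(3,4)]]]
        late_conj[OF Z l1 l2]]
    then show ?thesis
    proof (rule late_mono, elim conjE)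
      fix k n
      assume k: "(w (l, m), k) \<in> le Z" "(w (l', m'), k) \<in> le Z"
        and e1: "htop_comp (sp Z k) (sp X l) (bond X l l') (level Z X s k n l') = level Z X s k n l"
        and e2: "htop_comp (sp Z k) (sp Y m) (bond Y m m') (level Z Y t k n m') = level Z Y t k n m"
      let ?b = "htop_prod (sp X l') (sp Y m') (sp X l) (sp Y m) (bond X l l') (bond Y m m')"
      have b: "?b \<in> htop_hom (prod_topology (sp X l') (sp Y m')) (prod_topology (sp X l) (sp Y m))"
        using bX bY by (rule htop_prod_in_hom)
      note v = lev_hom[OF lm(3,4) k(2), of n]
      show "htop_comp (sp Z k) (prod_topology (sp X l) (sp Y m)) ?b (?lev k n (l', m')) = ?lev k n (l, m)"
      proof (rule htop_prod_ext[OF htop_comp_in_hom[OF v b] lev_hom[OF lm(1,2) k(1)]])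
        show "htop_comp (sp Z k) (sp X l) (htop_fst (sp X l) (sp Y m))
            (htop_comp (sp Z k) (prod_topology (sp X l) (sp Y m)) ?b (?lev k n (l', m')))
          = htop_comp (sp Z k) (sp X l) (htop_fst (sp X l) (sp Y m)) (?lev k n (l, m))"
          unfolding htop_comp_assoc[OF v b htop_fst_in_hom, symmetric] htop_class_fst_comp_prod[OF bX bY]
            htop_comp_assoc[OF v htop_fst_in_hom bX] lev1[OF lm(1,2) k(1)] lev1[OF lm(3,4) k(2)]
          by (rule e1)
        show "htop_comp (sp Z k) (sp Y m) (htop_snd (sp X l) (sp Y m))
            (htop_comp (sp Z k) (prod_topology (sp X l) (sp Y m)) ?b (?lev k n (l', m')))
          = htop_comp (sp Z k) (sp Y m) (htop_snd (sp X l) (sp Y m)) (?lev k n (l, m))"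
          unfolding htop_comp_assoc[OF v b htop_snd_in_hom, symmetric] htop_class_snd_comp_prod[OF bX bY]
            htop_comp_assoc[OF v htop_snd_in_hom bY] lev2[OF lm(1,2) k(1)] lev2[OF lm(3,4) k(2)]
          by (rule e2)
      qed
    qed
  qed
  have u: "u \<in> s_mor Z (prod_system X Y)"
    using coherent wZ H(1) by (auto simp: s_mor_iff[OF Z XY] u_def)
  obtain l0 m0 where l0: "l0 \<in> idx X" and m0: "m0 \<in> idx Y"
    using inverse_system_nonempty[OF X] inverse_system_nonempty[OF Y] by blast
  have "late Z (\<lambda>k n. level Z X (s_comp Z X (proj1_rep X Y m0) u) k n l = level Z X s k n l)"
    if l: "l \<in> idx X" for l
    using late_above[OF Z wZ[OF l m0]]
  proof (rule late_mono)
    fix k n assume k: "(w (l, m0), k) \<in> le Z"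
    then have "(fst u (l, m0), k) \<in> le Z"
      "snd u n (l, m0) \<in> htop_hom (sp Z (fst u (l, m0))) (prod_topology (sp X l) (sp Y m0))"
      using H(1)[OF l m0] by (simp_all add: u_def)
    then show "level Z X (s_comp Z X (proj1_rep X Y m0) u) k n l = level Z X s k n l"
      by (simp add: level_proj1[OF Z] lev1[OF l m0 k])
  qed
  then have "(s_comp Z X (proj1_rep X Y m0) u, s) \<in> s_equiv Z X"
    using s_comp_proj1_in_s_mor[OF X Y Z u m0] s by (simp add: s_equiv_iff[OF Z X])
  then have 1: "pro_comp Z X (proj1 X Y) (pro_class Z (prod_system X Y) u) = f"
    using s_comp_proj1_in_s_mor[OF X Y Z u m0] s
    by (simp add: pro_comp_proj1[OF X Y Z u m0] pro_class_eq_iff[OF Z])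
  have "late Z (\<lambda>k n. level Z Y (s_comp Z Y (proj2_rep X Y l0) u) k n m = level Z Y t k n m)"
    if m: "m \<in> idx Y" for m
    using late_above[OF Z wZ[OF l0 m]]
  proof (rule late_mono)
    fix k n assume k: "(w (l0, m), k) \<in> le Z"
    then have "(fst u (l0, m), k) \<in> le Z"
      "snd u n (l0, m) \<in> htop_hom (sp Z (fst u (l0, m))) (prod_topology (sp X l0) (sp Y m))"
      using H(1)[OF l0 m] by (simp_all add: u_def)
    then show "level Z Y (s_comp Z Y (proj2_rep X Y l0) u) k n m = level Z Y t k n m"
      by (simp add: level_proj2[OF Z] lev2[OF l0 m k])
  qed
  then have "(s_comp Z Y (proj2_rep X Y l0) u, t) \<in> s_equiv Z Y"
    using s_comp_proj2_in_s_mor[OF X Y Z u l0] t by (simp add: s_equiv_iff[OF Z Y])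
  then have 2: "pro_comp Z Y (proj2 X Y) (pro_class Z (prod_system X Y) u) = g"
    using s_comp_proj2_in_s_mor[OF X Y Z u l0] t
    by (simp add: pro_comp_proj2[OF X Y Z u l0] pro_class_eq_iff[OF Z])
  from 1 2 pro_class_in_hom[OF u] show ?thesis
    by blast
qed

theorem theorem2p1:
  fixes X :: "('i, 'a) inv_system"
    and Y :: "('j, 'b) inv_system"
    and Z :: "('k, 'c) inv_system"
  assumes "inverse_system X" and "inverse_system Y" and "inverse_system Z"
    and "f \<in> pro_hom Z X" and "g \<in> pro_hom Z Y"
  shows "\<exists>!h. h \<in> pro_hom Z (prod_system X Y) \<and>
           pro_comp Z X (proj1 X Y) h = f \<and>
           pro_comp Z Y (proj2 X Y) h = g"
proof (rule ex_ex1I)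
  show "\<exists>h. h \<in> pro_hom Z (prod_system X Y) \<and>
      pro_comp Z X (proj1 X Y) h = f \<and> pro_comp Z Y (proj2 X Y) h = g"
    using pro_pair_exists[OF assms] by blast
next
  fix h h'
  assume "h \<in> pro_hom Z (prod_system X Y) \<and>
      pro_comp Z X (proj1 X Y) h = f \<and> pro_comp Z Y (proj2 X Y) h = g"
    and "h' \<in> pro_hom Z (prod_system X Y) \<and>
      pro_comp Z X (proj1 X Y) h' = f \<and> pro_comp Z Y (proj2 X Y) h' = g"
  then show "h = h'"
    by (intro pro_prod_ext[OF assms(1-3)]) simp_all
qed

end
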